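(* Let $A$ be a finite set and let $X \subset A^{\mathbb{Z}}$ be a subshift of finite type. Then $X$ is surjunctive if and only if $X$ is the disjoint union of a non-wandering subshift of finite type and of an injunctive subshift of finite type.
   Context: $A^{\mathbb{Z}}$ carries the product topology ($A$ discrete) and the shift homeomorphism $\sigma$, $(\sigma(x))_i = x_{i+1}$. A subshift is a closed subset $X\subset A^{\mathbb{Z}}$ with $\sigma(X)=X$ (possibly empty). It is of finite type if there are an integer $n\ge 0$ and $S\subset A^n$ such that $X$ is the set of all $x\in A^{\mathbb{Z}}$ with $(x_{i+1},\dots,x_{i+n})\in S$ for all $i\in\mathbb{Z}$. An endomorphism of $X$ is a continuous map $\tau\colon X\to X$ commuting with $\sigma$. $X$ is surjunctive if every injective endomorphism of $X$ is surjective, and injunctive if every surjective endomorphism of $X$ is injective. A subshift $Y$ is non-wandering if for every $x\in Y$ and every neighborhood $U$ of $x$ in $Y$ there is $n\ge 1$ with $U\cap\sigma^n(U)\ne\varnothing$. *)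

theory Defs
  imports "HOL-Analysis.Analysis"
begin

definition full_shift :: "'a set \<Rightarrow> (int \<Rightarrow> 'a) topology" where
  "full_shift A = product_topology (\<lambda>_. discrete_topology A) UNIV"

definition shift :: "(int \<Rightarrow> 'a) \<Rightarrow> int \<Rightarrow> 'a" where
  "shift x = (\<lambda>i. x (i + 1))"

definition subshift :: "'a set \<Rightarrow> (int \<Rightarrow> 'a) set \<Rightarrow> bool" where
  "subshift A X \<longleftrightarrow> closedin (full_shift A) X \<and> shift ` X = X"

text \<open>Elements of \<open>A\<^sup>n\<close> are represented by lists of length \<open>n\<close> with entries in \<open>A\<close>;
  \<open>window x i n\<close> is the word \<open>(x\<^bsub>i+1\<^esub>, \<dots>, x\<^bsub>i+n\<^esub>)\<close>.\<close>

definition window :: "(int \<Rightarrow> 'a) \<Rightarrow> int \<Rightarrow> nat \<Rightarrow> 'a list" where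
  "window x i n = map (\<lambda>k. x (i + int k)) [1..<n + 1]"

definition subshift_of_finite_type :: "'a set \<Rightarrow> (int \<Rightarrow> 'a) set \<Rightarrow> bool" where
  "subshift_of_finite_type A X \<longleftrightarrow> subshift A X \<and>
     (\<exists>(n::nat) S. S \<subseteq> {w. length w = n \<and> set w \<subseteq> A} \<and>
        X = {x. range x \<subseteq> A \<and> (\<forall>i. window x i n \<in> S)})"

text \<open>Maps \<open>X \<rightarrow> X\<close> are represented by total functions whose values outside \<open>X\<close> are irrelevant.\<close>

definition endomorphism :: "'a set \<Rightarrow> (int \<Rightarrow> 'a) set \<Rightarrow> ((int \<Rightarrow> 'a) \<Rightarrow> (int \<Rightarrow> 'a)) \<Rightarrow> bool" where
  "endomorphism A X \<tau> \<longleftrightarrow>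
     continuous_map (subtopology (full_shift A) X) (subtopology (full_shift A) X) \<tau> \<and>
     (\<forall>x\<in>X. \<tau> (shift x) = shift (\<tau> x))"

definition surjunctive :: "'a set \<Rightarrow> (int \<Rightarrow> 'a) set \<Rightarrow> bool" where
  "surjunctive A X \<longleftrightarrow> (\<forall>\<tau>. endomorphism A X \<tau> \<and> inj_on \<tau> X \<longrightarrow> \<tau> ` X = X)"

definition injunctive :: "'a set \<Rightarrow> (int \<Rightarrow> 'a) set \<Rightarrow> bool" where
  "injunctive A X \<longleftrightarrow> (\<forall>\<tau>. endomorphism A X \<tau> \<and> \<tau> ` X = X \<longrightarrow> inj_on \<tau> X)"

definition non_wandering :: "'a set \<Rightarrow> (int \<Rightarrow> 'a) set \<Rightarrow> bool" where
  "non_wandering A Y \<longleftrightarrow>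
     (\<forall>x\<in>Y. \<forall>U\<subseteq>Y. (\<exists>V. openin (subtopology (full_shift A) Y) V \<and> x \<in> V \<and> V \<subseteq> U) \<longrightarrow>
        (\<exists>n::nat. n \<ge> 1 \<and> U \<inter> (shift ^^ n) ` U \<noteq> {}))"

end

theory Submission
  imports Defs
begin

text \<open>
  Call \<open>X\<close> directly finite if a one-sided inverse of an endomorphism is two-sided. Both surjunctive
  and injunctive subshifts are directly finite, and the core is that a directly finite shift of finite
  type is a non-wandering one together with finitely many orbits.

  View \<open>X\<close> as a path space, the states being words of length \<open>n\<close>, and let \<open>M\<close> be a set of recurrent
  states containing every recurrent predecessor of its members. Shifting a path by \<open>L\<close> up to its last
  visit to \<open>M\<close>, keeping the rest in place and filling the gap with a cycle of length \<open>L\<close>, is an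
  endomorphism: recurrent states occur with bounded gaps, so it is locally decidable whether the last
  visit is still to come. It has a left inverse, because by the pigeonhole principle every long enough
  path can be shortened by \<open>L\<close>. Direct finiteness thus makes the left ray ending at the last visit
  unique. By reflection, every recurrent state met by a wandering point determines its left ray or its
  right ray, and so the wandering points and their limits form finitely many orbits.

  Conversely, if \<open>X\<close> is the union of the closure of its periodic points and finitely many orbits, then an
  injective endomorphism permutes the points of each period, hence is onto the closure, and
  permutes the remaining orbits.
\<close>

section \<open>Translations, splicing and local endomorphisms\<close>

definition translate :: "int \<Rightarrow> (int \<Rightarrow> 'a) \<Rightarrow> int \<Rightarrow> 'a" where
  "translate k x = (\<lambda>i. x (i + k))"

definition splice_at :: "int \<Rightarrow> (int \<Rightarrow> 'a) \<Rightarrow> (int \<Rightarrow> 'a) \<Rightarrow> int \<Rightarrow> 'a" where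
  "splice_at t x y = (\<lambda>i. if i \<le> t then x i else y i)"

text \<open>Endomorphisms in Curtis-Hedlund-Lyndon form: by equivariance, a finite window for
  coordinate \<open>0\<close> makes every coordinate local. This keeps the combinatorics free of
  topology.\<close>

definition local_endo :: "(int \<Rightarrow> 'a) set \<Rightarrow> ((int \<Rightarrow> 'a) \<Rightarrow> int \<Rightarrow> 'a) \<Rightarrow> bool" where
  "local_endo X \<tau> \<longleftrightarrow> (\<forall>x\<in>X. \<tau> x \<in> X) \<and>
     (\<forall>x\<in>X. \<forall>k. \<tau> (translate k x) = translate k (\<tau> x)) \<and>
     (\<exists>N. \<forall>x\<in>X. \<forall>y\<in>X. (\<forall>j\<in>{-N..N}. x j = y j) \<longrightarrow> \<tau> x 0 = \<tau> y 0)"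

text \<open>Direct finiteness of the endomorphism monoid: if \<open>\<rho>\<close> is a left inverse
  of \<open>\<tau>\<close> and \<open>\<tau>\<close> is onto, then \<open>\<rho>\<close> is also a
  right inverse on \<open>X\<close>.\<close>

definition directly_finite :: "(int \<Rightarrow> 'a) set \<Rightarrow> bool" where
  "directly_finite X \<longleftrightarrow> (\<forall>\<rho> \<tau>. local_endo X \<rho> \<and> local_endo X \<tau> \<and> (\<forall>x\<in>X. \<rho> (\<tau> x) = x)
     \<longrightarrow> \<tau> ` X = X)"

lemma translate_apply [simp]: "translate k x i = x (i + k)"
  by (simp add: translate_def)

lemma translate_translate [simp]: "translate k (translate l x) = translate (k + l) x"
  by (auto simp: translate_def fun_eq_iff add_ac)

lemma translate_0 [simp]: "translate 0 x = x"
  by (auto simp: translate_def)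

lemma translate_eq_iff: "translate k x = translate l y \<longleftrightarrow> x = translate (l - k) y"
proof
  assume "translate k x = translate l y"
  then have "translate (-k) (translate k x) = translate (-k) (translate l y)" by simp
  then show "x = translate (l - k) y" by simp
qed simp

lemma translate_multiple:
  assumes "translate L c = c"
  shows "translate (L * m) c = c"
proof -
  have nat: "translate (L * int m) c = c" for m
  proof (induction m)
    case (Suc m)
    have "translate (L * int (Suc m)) c = translate L (translate (L * int m) c)"
      by (simp add: algebra_simps del: translate_apply)
    then show ?case using Suc assms by simp
  qed simp
  show ?thesis
  proof (cases "m \<ge> 0")
    case True then show ?thesis using nat[of "nat m"] by simp
  next
    case False
    then have "translate (- (L * m)) c = c" using nat[of "nat (- m)"] by simp
    then show ?thesis using translate_eq_iff[of "- (L * m)" c 0 c] by simp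
  qed
qed

lemma finite_periodic_points:
  assumes "finite A" "L > 0"
  shows "finite {x. range x \<subseteq> A \<and> translate L x = x}" (is "finite ?P")
proof (rule inj_on_finite)
  let ?f = "\<lambda>x. restrict x {0..<L}"
  show "inj_on ?f ?P"
  proof (rule inj_onI)
    fix x y assume x: "x \<in> ?P" and y: "y \<in> ?P" and eq: "?f x = ?f y"
    show "x = y"
    proof
      fix j
      have red: "z j = z (j mod L)" if "z \<in> ?P" for z
        using fun_cong[OF translate_multiple[of L z "j div L"], of "j mod L"] that by (simp add: mult.commute)
      have "x (j mod L) = y (j mod L)" using fun_cong[OF eq, of "j mod L"] assms by simp
      then show "x j = y j" using red[OF x] red[OF y] by simp
    qed
  qed
  show "?f ` ?P \<subseteq> PiE {0..<L} (\<lambda>_. A)" by auto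
qed (use assms in \<open>simp add: finite_PiE\<close>)

lemma window_eq_iff: "window x i m = window y j m \<longleftrightarrow> (\<forall>k. 0 < k \<and> k \<le> int m \<longrightarrow> x (i + k) = y (j + k))"
proof
  assume eq: "window x i m = window y j m"
  show "\<forall>k. 0 < k \<and> k \<le> int m \<longrightarrow> x (i + k) = y (j + k)"
  proof (intro allI impI)
    fix k assume k: "0 < k \<and> k \<le> int m"
    then have "nat k \<in> set [1..<m + 1]" by auto
    with eq have "x (i + int (nat k)) = y (j + int (nat k))"
      unfolding window_def map_eq_conv by blast
    then show "x (i + k) = y (j + k)" using k by simp
  qed
qed (auto simp: window_def)

lemma length_window: "length (window x i m) = m"
  by (simp add: window_def)

lemma set_window: "range x \<subseteq> A \<Longrightarrow> set (window x i m) \<subseteq> A"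
  by (auto simp: window_def)

section \<open>States of a shift of finite type\<close>

locale finite_type =
  fixes A :: "'a set" and n :: nat and S :: "'a list set" and X :: "(int \<Rightarrow> 'a) set"
  assumes finite_alphabet: "finite A"
    and X_def: "X = {x. range x \<subseteq> A \<and> (\<forall>i. window x i n \<in> S)}"
begin

text \<open>The \<open>n\<close> symbols ending at time \<open>i\<close>, time \<open>i\<close>
  included: equal states at \<open>t\<close> permit gluing a past up to \<open>t\<close> to a future
  after \<open>t\<close>.\<close>

definition st :: "(int \<Rightarrow> 'a) \<Rightarrow> int \<Rightarrow> 'a list" where
  "st x i = window x (i - int n) n"

lemma st_eq_iff: "st x i = st y j \<longleftrightarrow> (\<forall>k. 0 \<le> k \<and> k < int n \<longrightarrow> x (i - k) = y (j - k))"
proof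
  assume "st x i = st y j"
  then have eq: "x (i - int n + k) = y (j - int n + k)" if "0 < k" "k \<le> int n" for k
    using that by (simp add: st_def window_eq_iff)
  show "\<forall>k. 0 \<le> k \<and> k < int n \<longrightarrow> x (i - k) = y (j - k)"
    using eq[of "int n - _"] by (auto simp: algebra_simps)
next
  assume eq: "\<forall>k. 0 \<le> k \<and> k < int n \<longrightarrow> x (i - k) = y (j - k)"
  show "st x i = st y j"
    unfolding st_def window_eq_iff
    using eq[rule_format, of "int n - _"] by (auto simp: algebra_simps)
qed

lemma st_cong: "(\<And>k. i - int n < k \<Longrightarrow> k \<le> i \<Longrightarrow> x k = y k) \<Longrightarrow> st x i = st y i"
  by (auto simp: st_eq_iff)

lemma st_translate [simp]: "st (translate k x) i = st x (i + k)"
  by (auto simp: st_eq_iff algebra_simps)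

lemma X_iff: "x \<in> X \<longleftrightarrow> range x \<subseteq> A \<and> (\<forall>i. st x i \<in> S)"
proof -
  have "(\<forall>i. window x i n \<in> S) \<longleftrightarrow> (\<forall>i. window x (i - int n) n \<in> S)"
    by (metis add_diff_cancel_right')
  then show ?thesis by (simp add: X_def st_def)
qed

lemma translate_in_X: "x \<in> X \<Longrightarrow> translate k x \<in> X"
  by (auto simp: X_iff)

lemma st_splice_le: "i \<le> t \<Longrightarrow> st (splice_at t x y) i = st x i"
  by (rule st_cong) (auto simp: splice_at_def)

lemma st_splice_ge: "st x t = st y t \<Longrightarrow> t \<le> i \<Longrightarrow> st (splice_at t x y) i = st y i"
proof (rule st_cong)
  fix k assume eq: "st x t = st y t" and "t \<le> i" "i - int n < k" "k \<le> i"
  then have "k \<le> t \<Longrightarrow> x (t - (t - k)) = y (t - (t - k))"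
    by (intro eq[unfolded st_eq_iff, rule_format]) auto
  then show "splice_at t x y k = y k" by (auto simp: splice_at_def)
qed

text \<open>Every state of the spliced point is one of \<open>x\<close> up to \<open>t\<close> and
  one of \<open>y\<close> from \<open>t\<close> on, so the seam creates no forbidden word.\<close>

lemma splice_in_X:
  assumes "x \<in> X" "y \<in> X" "st x t = st y t"
  shows "splice_at t x y \<in> X"
proof -
  have "st (splice_at t x y) i \<in> S" for i
    using assms st_splice_le[of i t x y] st_splice_ge[of x t y i]
    by (cases "i \<le> t") (auto simp: X_iff)
  then show ?thesis using assms by (auto simp: X_iff splice_at_def)
qed

definition states :: "'a list set" where
  "states = {st x i |x i. x \<in> X}"

lemma st_in_states: "x \<in> X \<Longrightarrow> st x i \<in> states"
  by (auto simp: states_def)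

lemma finite_states: "finite states"
proof (rule finite_subset)
  show "states \<subseteq> {w. set w \<subseteq> A \<and> length w = n}"
    using set_window[where A = A] by (auto simp: states_def st_def X_iff length_window)
qed (use finite_lists_length_eq[OF finite_alphabet] in blast)

section \<open>Reachability, recurrence and closing up paths\<close>

definition reach :: "'a list \<Rightarrow> 'a list \<Rightarrow> bool" where
  "reach u v \<longleftrightarrow> (\<exists>x\<in>X. \<exists>i j. i \<le> j \<and> st x i = u \<and> st x j = v)"

text \<open>The strict inequality demands a nonempty cycle; \<open>reach\<close> is already
  reflexive on states.\<close>

definition recurrent :: "'a list \<Rightarrow> bool" where
  "recurrent u \<longleftrightarrow> (\<exists>x\<in>X. \<exists>i j. i < j \<and> st x i = u \<and> st x j = u)"

lemma reachI: "x \<in> X \<Longrightarrow> i \<le> j \<Longrightarrow> reach (st x i) (st x j)"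
  by (auto simp: reach_def)

lemma recurrentI: "x \<in> X \<Longrightarrow> i < j \<Longrightarrow> st x i = st x j \<Longrightarrow> recurrent (st x i)"
  by (metis recurrent_def)

lemma path_append:
  assumes "x \<in> X" "y \<in> X" "i \<le> j" "k \<le> l" "st x j = st y k"
  obtains z where "z \<in> X" "st z i = st x i" "st z (j + (l - k)) = st y l" "st z j = st x j"
    "\<And>m. m \<le> j \<Longrightarrow> st z m = st x m" "\<And>m. m \<ge> j \<Longrightarrow> st z m = st y (m + (k - j))"
    "\<And>m. m \<le> j \<Longrightarrow> z m = x m" "\<And>m. m > j \<Longrightarrow> z m = y (m + (k - j))"
proof
  let ?z = "splice_at j x (translate (k - j) y)"
  have eq: "st x j = st (translate (k - j) y) j" using assms by simp
  show "?z \<in> X" using assms eq by (intro splice_in_X translate_in_X) auto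
  show le: "\<And>m. m \<le> j \<Longrightarrow> st ?z m = st x m" by (rule st_splice_le)
  show ge: "\<And>m. m \<ge> j \<Longrightarrow> st ?z m = st y (m + (k - j))" using st_splice_ge[OF eq] by simp
  show "st ?z i = st x i" "st ?z j = st x j" using le assms by auto
  show "st ?z (j + (l - k)) = st y l" using ge[of "j + (l - k)"] assms by simp
qed (auto simp: splice_at_def)

lemma reach_trans: "reach u v \<Longrightarrow> reach v w \<Longrightarrow> reach u w"
proof -
  assume "reach u v" "reach v w"
  then obtain x y i j k l where *: "x \<in> X" "i \<le> j" "st x i = u" "st x j = v"
    "y \<in> X" "k \<le> l" "st y k = v" "st y l = w" by (auto simp: reach_def)
  obtain z where "z \<in> X" "st z i = st x i" "st z (j + (l - k)) = st y l"
    using path_append[OF *(1,5,2,6)] * by metis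
  then show "reach u w" using * reachI[of z i "j + (l - k)"] by simp
qed

text \<open>Pigeonhole on pairs of a state and a time modulo \<open>L\<close>. A return time
  divisible by \<open>L\<close> allows the loop to be replaced by repetitions of a cycle of length
  \<open>L\<close>.\<close>

lemma return_pigeonhole:
  fixes L :: nat
  assumes "x \<in> X" "L > 0"
  obtains a b where "i \<le> a" "a < b" "b \<le> i + int (card states * L)" "st x a = st x b" "int L dvd b - a"
proof -
  let ?f = "\<lambda>j. (st x j, j mod int L)"
  let ?I = "{i..i + int (card states * L)}"
  have "?f ` ?I \<subseteq> states \<times> {0..<int L}" using assms st_in_states by auto
  then have "card (?f ` ?I) \<le> card (states \<times> {0..<int L})"
    by (intro card_mono) (auto simp: finite_states)
  also have "\<dots> = card states * L" by (simp add: card_cartesian_product)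
  also have "\<dots> < card ?I" by (simp del: of_nat_mult)
  finally have "\<not> inj_on ?f ?I" by (rule pigeonhole)
  then obtain a b where ab: "a \<in> ?I" "b \<in> ?I" "a \<noteq> b" "st x a = st x b" "a mod int L = b mod int L"
    by (auto simp: inj_on_def)
  have "int L dvd b - a" "int L dvd a - b" using ab(5) by (auto simp: mod_eq_dvd_iff dvd_diff_commute)
  then show ?thesis using that[of a b] that[of b a] ab by (cases "a < b") auto
qed

text \<open>Among \<open>card states + 1\<close> consecutive times some state repeats, and a
  repeated state is recurrent.\<close>

lemma recurrent_nearby:
  assumes "x \<in> X"
  obtains a where "i \<le> a" "a \<le> i + int (card states)" "recurrent (st x a)"
proof -
  obtain a b where "i \<le> a" "a < b" "b \<le> i + int (card states * 1)" "st x a = st x b"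
    using return_pigeonhole[OF assms, of 1 i] by auto
  then show ?thesis using that[of a] recurrentI[OF assms] by auto
qed

text \<open>Repeating the block after \<open>i\<close> is legal because at least \<open>n\<close>
  symbols match at the seam. Taking \<open>N\<close> larger than \<open>n\<close> keeps
  \<open>c\<close> equal to \<open>x\<close> on a long window, as the density of periodic points
  requires.\<close>

lemma periodic_closing:
  assumes x: "x \<in> X" and L: "L > 0" and N: "n \<le> N"
    and eq: "\<And>k. 0 \<le> k \<Longrightarrow> k < int N \<Longrightarrow> x (i - k) = x (i + L - k)"
  obtains c where "c \<in> X" "translate L c = c" "\<And>j. - int N < j \<Longrightarrow> j \<le> L \<Longrightarrow> c j = x (i + j)"
proof
  \<comment> \<open>The offset by one makes positions \<open>i + 1\<close> to \<open>i + L\<close>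
    the repeated block.\<close>
  let ?c = "\<lambda>j. x (i + 1 + ((j - 1) mod L))"
  show per: "translate L ?c = ?c"
  proof
    fix j
    have "(j + L - 1) mod L = (j - 1 + L) mod L" by (simp add: algebra_simps)
    also have "\<dots> = (j - 1) mod L" by simp
    finally show "translate L ?c j = ?c j" by simp
  qed
  have pos: "?c j = x (i + j)" if "1 \<le> j" "j \<le> L" for j
    using that by simp
  \<comment> \<open>Leftward agreement is obtained \<open>L\<close> positions at a time; the
    induction is needed because \<open>L\<close> may be smaller than \<open>N\<close>.\<close>
  have neg: "- int N < 1 - int m \<Longrightarrow> 1 - int m \<le> L \<Longrightarrow> ?c (1 - int m) = x (i + (1 - int m))" for m
  proof (induction m rule: less_induct)
    case (less m)
    show ?case
    proof (cases "m = 0")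
      case True then show ?thesis using L pos[of 1] by simp
    next
      case False
      have "?c (1 - int m) = ?c (1 - int m + L)" using fun_cong[OF per, of "1 - int m"] by simp
      also have "\<dots> = x (i + (1 - int m + L))"
      proof (cases "1 - int m + L \<ge> 1")
        case True
        then show ?thesis using pos[of "1 - int m + L"] False by simp
      next
        case F: False
        have "1 - int m + L = 1 - int (m - nat L)" using F L by (simp add: of_nat_diff)
        then show ?thesis using less.IH[of "m - nat L"] less.prems L F False
            by (simp add: algebra_simps)
      qed
      also have "\<dots> = x (i + (1 - int m))"
        using eq[of "int m - 1"] False less.prems by (simp add: algebra_simps)
      finally show ?thesis .
    qed
  qed
  show agree: "?c j = x (i + j)" if "- int N < j" "j \<le> L" for j
  proof (cases "1 \<le> j")
    case True then show ?thesis using pos that by blast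
  next
    case False
    then show ?thesis using neg[of "nat (1 - j)"] that by simp
  qed
  have base: "st ?c j = st x (i + j)" if "0 \<le> j" "j \<le> L" for j
    unfolding st_eq_iff
  proof (intro allI impI)
    fix k assume "0 \<le> k \<and> k < int n"
    then show "?c (j - k) = x (i + j - k)" using agree[of "j - k"] that N by (simp add: algebra_simps)
  qed
  have mult: "translate (L * m) ?c = ?c" for m
    using per by (rule translate_multiple)
  show "?c \<in> X"
    unfolding X_iff
  proof
    show "range ?c \<subseteq> A" using x by (auto simp: X_iff)
    show "\<forall>j. st ?c j \<in> S"
    proof
      fix j
      have "st ?c j = st (translate (L * (j div L)) ?c) (j mod L)" 
        by (simp only: st_translate) (simp add: mult.commute)
      also have "\<dots> = st ?c (j mod L)" by (simp only: mult)
      also have "\<dots> = st x (i + j mod L)" using L by (intro base) (auto simp: less_imp_le)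
      finally show "st ?c j \<in> S" using x by (simp add: X_iff)
    qed
  qed
qed

end

section \<open>Inserting and removing a cycle\<close>

text \<open>One length \<open>L\<close> serves all of \<open>M\<close>, so that every path is
  delayed by the same amount. \<open>cyc q\<close> is a periodic path through \<open>q\<close> at
  time \<open>0\<close>; \<open>L\<close> need not be its least period.\<close>

locale cycle_insertion = finite_type +
  fixes M :: "'a list set" and L :: nat and cyc :: "'a list \<Rightarrow> int \<Rightarrow> 'a"
  assumes L_pos: "L > 0"
    and cyc: "q \<in> M \<Longrightarrow> cyc q \<in> X" "q \<in> M \<Longrightarrow> translate (int L) (cyc q) = cyc q"
      "q \<in> M \<Longrightarrow> st (cyc q) 0 = q"
    and M_pred: "x \<in> X \<Longrightarrow> s \<le> t \<Longrightarrow> st x t \<in> M \<Longrightarrow> recurrent (st x s) \<Longrightarrow> st x s \<in> M"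
begin

section \<open>Last visits to \<open>M\<close> and the two maps\<close>

definition live :: "(int \<Rightarrow> 'a) \<Rightarrow> int \<Rightarrow> bool" where
  "live x i \<longleftrightarrow> (\<exists>s\<ge>i. st x s \<in> M)"

definition final :: "(int \<Rightarrow> 'a) \<Rightarrow> int \<Rightarrow> bool" where
  "final x t \<longleftrightarrow> st x t \<in> M \<and> (\<forall>s>t. st x s \<notin> M)"

text \<open>Only consulted when the point is live at one time and dead at a later one, in which case
  \<open>final_between\<close> provides a last visit.\<close>

definition final_time :: "(int \<Rightarrow> 'a) \<Rightarrow> int" where
  "final_time x = (THE t. final x t)"

lemma final_live: "final x t \<Longrightarrow> live x i \<longleftrightarrow> i \<le> t"
  unfolding final_def live_def by (meson le_less_linear order_trans)

lemma final_time_eq: "final x t \<Longrightarrow> final_time x = t"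
  unfolding final_time_def
  by (rule the_equality) (auto simp: final_def not_less intro!: antisym dest: leI)

lemma final_between:
  assumes "live x i" "\<not> live x j"
  obtains t where "final x t" "i \<le> t" "t < j"
proof -
  obtain s where s: "s \<ge> i" "st x s \<in> M" using assms by (auto simp: live_def)
  have bd: "r < j" if "st x r \<in> M" for r using assms(2) that unfolding live_def by (meson not_less)
  let ?R = "{r \<in> {i..<j}. st x r \<in> M}"
  have fin: "finite ?R" by (rule finite_subset[of _ "{i..<j}"]) auto
  have ne: "?R \<noteq> {}" using s bd by auto
  have "Max ?R \<in> ?R" using fin ne by (rule Max_in)
  moreover have "r \<le> Max ?R" if "r \<in> ?R" for r using that fin by simp
  ultimately have "final x (Max ?R)" unfolding final_def
    by (smt (verit, best) atLeastLessThan_iff bd mem_Collect_eq)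
  then show ?thesis using that \<open>Max ?R \<in> ?R\<close> by auto
qed

text \<open>Points that never meet \<open>M\<close> and points that meet it arbitrarily late have no
  last visit; the two maps below treat them as identity and as a pure translation.\<close>

lemma live_cases:
  assumes "x \<in> X"
  obtains "\<And>i. \<not> live x i" | "\<And>i. live x i" | t where "final x t"
  using final_between by metis

lemma live_translate: "live (translate k x) i \<longleftrightarrow> live x (i + k)"
proof
  assume "live (translate k x) i"
  then obtain s where "s \<ge> i" "st x (s + k) \<in> M" by (auto simp: live_def)
  then show "live x (i + k)" by (auto simp: live_def intro!: exI[of _ "s + k"])
next
  assume "live x (i + k)"
  then obtain s where "s \<ge> i + k" "st x s \<in> M" by (auto simp: live_def)
  then show "live (translate k x) i" by (auto simp: live_def intro!: exI[of _ "s - k"])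
qed

lemma final_translate: "final x t \<Longrightarrow> final (translate k x) (t - k)"
  by (auto simp: final_def)

text \<open>With last visit \<open>t\<close>, the three cases are \<open>i \<le> t - L\<close>,
  \<open>t - L < i \<le> t\<close> and \<open>i > t\<close>. Phrasing them through
  \<open>live\<close> also covers points without a last visit and exposes locality.\<close>

definition insert_cycle :: "(int \<Rightarrow> 'a) \<Rightarrow> int \<Rightarrow> 'a" where
  "insert_cycle x i = (if live x (i + int L) then x (i + int L)
     else if live x i then cyc (st x (final_time x)) (i - final_time x) else x i)"

text \<open>The length within which \<open>return_pigeonhole\<close> finds a loop that can be
  shortened by \<open>L\<close>.\<close>

definition span :: int where
  "span = int (card states * L)"

definition ends_in_cycle :: "(int \<Rightarrow> 'a) \<Rightarrow> bool" where
  "ends_in_cycle u \<longleftrightarrow> (\<forall>j\<in>{- int L..0}. st u j = st (cyc (st u 0)) j)"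

text \<open>Meant for a path \<open>u\<close> with its last visit at \<open>0\<close>:
  \<open>z\<close> leads from \<open>st u (- span)\<close> to \<open>st u 0\<close> in
  \<open>L\<close> fewer steps. The last clause forces mere deletion of the cycle if
  \<open>u\<close> ends in it, which makes removal undo insertion.\<close>

definition shortening :: "(int \<Rightarrow> 'a) \<Rightarrow> (int \<Rightarrow> 'a) \<Rightarrow> bool" where
  "shortening u z \<longleftrightarrow> z \<in> X \<and> st z (int L - span) = st u (- span) \<and> st z 0 = st u 0 \<and>
     (ends_in_cycle u \<longrightarrow> (\<forall>i\<in>{int L - span<..0}. z i = u (i - int L)))"

text \<open>With last visit \<open>t\<close>, the path up to \<open>t - span\<close> is moved right
  by \<open>L\<close>, and a chosen shortening fills the time from there to
  \<open>t\<close>.\<close>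

definition remove_cycle :: "(int \<Rightarrow> 'a) \<Rightarrow> int \<Rightarrow> 'a" where
  "remove_cycle x i = (if live x (i + span - int L) then x (i - int L)
     else if live x i then (SOME z. shortening (translate (final_time x) x) z) (i - final_time x)
     else x i)"

lemma states_nonempty: "x \<in> X \<Longrightarrow> card states > 0"
  using st_in_states finite_states by (metis card_gt_0_iff empty_iff)

lemma L_le_span: "x \<in> X \<Longrightarrow> int L \<le> span"
  using states_nonempty[of x] by (simp add: span_def Suc_le_eq flip: of_nat_mult)

lemma cyc_back: "q \<in> M \<Longrightarrow> st (cyc q) (- (int L * int m)) = q"
proof (induction m)
  case (Suc m)
  have "st (cyc q) (- (int L * int (Suc m))) = st (translate (int L) (cyc q)) (- (int L * int (Suc m)))"
    using Suc cyc by simp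
  also have "\<dots> = st (cyc q) (- (int L * int m))" by (simp only: st_translate) (simp add: algebra_simps)
  finally show ?case using Suc by simp
qed (use cyc in simp)

lemma insert_cycle_final:
  assumes "final x t"
  shows "insert_cycle x = splice_at t (splice_at (t - int L) (translate (int L) x)
    (translate (- t) (cyc (st x t)))) x"
  using L_pos by (auto simp: fun_eq_iff insert_cycle_def splice_at_def final_live[OF assms] final_time_eq[OF assms])

lemma insert_cycle_dead: "(\<And>i. \<not> live x i) \<Longrightarrow> insert_cycle x = x"
  by (auto simp: insert_cycle_def)

lemma insert_cycle_live: "(\<And>i. live x i) \<Longrightarrow> insert_cycle x = translate (int L) x"
  by (auto simp: insert_cycle_def)

lemma insert_cycle_final_props:
  assumes x: "x \<in> X" and t: "final x t"
  shows "insert_cycle x \<in> X" "final (insert_cycle x) t"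
    "\<And>j. t - int L \<le> j \<Longrightarrow> j \<le> t \<Longrightarrow> st (insert_cycle x) j = st (cyc (st x t)) (j - t)"
    "st (insert_cycle x) t = st x t"
    "\<And>i. i \<le> t - int L \<Longrightarrow> insert_cycle x i = x (i + int L)"
    "\<And>i. t - int L < i \<Longrightarrow> i \<le> t \<Longrightarrow> insert_cycle x i = cyc (st x t) (i - t)"
    "\<And>i. i > t \<Longrightarrow> insert_cycle x i = x i"
proof -
  let ?c = "translate (- t) (cyc (st x t))"
  let ?y = "splice_at (t - int L) (translate (int L) x) ?c"
  have M: "st x t \<in> M" using t by (simp add: final_def)
  \<comment> \<open>One period before its visit at \<open>t\<close>, the cycle is again in state
    \<open>st x t\<close>, which is where the delayed left ray ends.\<close>
  have 1: "st (translate (int L) x) (t - int L) = st ?c (t - int L)"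
    using cyc_back[OF M, of 1] by simp
  have y: "?y \<in> X" using x M cyc 1 by (intro splice_in_X translate_in_X) auto
  have yc: "st ?y j = st (cyc (st x t)) (j - t)" if "t - int L \<le> j" for j
    using st_splice_ge[OF 1 that] by simp
  have 2: "st ?y t = st x t" using yc[of t] cyc[OF M] by simp
  note eq = insert_cycle_final[OF t]
  show "insert_cycle x \<in> X" unfolding eq using y x 2 by (rule splice_in_X)
  \<comment> \<open>States from \<open>t\<close> on are unchanged, so the last visit stays at
    \<open>t\<close>.\<close>
  have ge: "st (insert_cycle x) j = st x j" if "t \<le> j" for j
    using st_splice_ge[OF 2 that] eq by simp
  then show "final (insert_cycle x) t" "st (insert_cycle x) t = st x t" using t by (auto simp: final_def)
  show "st (insert_cycle x) j = st (cyc (st x t)) (j - t)" if "t - int L \<le> j" "j \<le> t" for j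
    using st_splice_le[OF that(2), of ?y x] yc[OF that(1)] eq by simp
qed (auto simp: insert_cycle_final[OF t] splice_at_def)

text \<open>If \<open>u\<close> ends in its cycle, dropping the last \<open>L\<close> steps works.
  Otherwise a loop of length \<open>L * m\<close> is replaced by \<open>m - 1\<close> rounds of the
  cycle at its base state.\<close>

lemma shortening_exists:
  assumes u: "u \<in> X" and M: "st u 0 \<in> M"
  shows "\<exists>z. shortening u z"
proof (cases "ends_in_cycle u")
  case True
  then have "st u (- int L) = st (cyc (st u 0)) (- int L)"
    unfolding ends_in_cycle_def by (rule bspec) simp
  also have "\<dots> = st u 0" using cyc_back[OF M, of 1] by simp
  finally show ?thesis using u
    by (intro exI[of _ "translate (- int L) u"]) (auto simp: shortening_def translate_in_X)
next
  case False
  obtain a b where ab: "- span \<le> a" "a < b" "b \<le> 0" "st u a = st u b" "int L dvd b - a"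
    using return_pigeonhole[OF u L_pos, of "- span"] unfolding span_def by auto
  \<comment> \<open>The base of the loop is recurrent and precedes a visit to \<open>M\<close>, so
    it lies in \<open>M\<close> and \<open>cyc\<close> is available there.\<close>
  have q: "st u a \<in> M" using M_pred[OF u _ M, of a] ab recurrentI[OF u ab(2,4)] by auto
  obtain m where m: "b - a = int L * m" using ab(5) by (auto simp: dvd_def)
  have "m > 0" using m ab(2) L_pos by (metis diff_gt_0_iff_gt of_nat_0_less_iff zero_less_mult_pos)
  then have m': "a + int L - b = - (int L * int (nat (m - 1)))" using m by (simp add: algebra_simps)
  have le: "a + int L \<le> b" using m' by (smt (verit) of_nat_0_le_iff mult_nonneg_nonneg)
  \<comment> \<open>The cycle is timed to be at the base state at \<open>b\<close>, hence also at
    \<open>a + L\<close>, a multiple of \<open>L\<close> earlier: \<open>u\<close> delayed, then the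
    cycle, then \<open>u\<close> again.\<close>
  let ?c = "translate (- b) (cyc (st u a))"
  let ?y = "splice_at (a + int L) (translate (- int L) u) ?c"
  let ?z = "splice_at b ?y u"
  have 1: "st (translate (- int L) u) (a + int L) = st ?c (a + int L)"
    using cyc_back[OF q, of "nat (m - 1)"] m' by simp
  have y: "?y \<in> X" using u q cyc 1 by (intro splice_in_X translate_in_X) auto
  have 2: "st ?y b = st u b" using st_splice_ge[OF 1 le] cyc(3)[OF q] ab by simp
  have "?z \<in> X" using y u 2 by (rule splice_in_X)
  moreover have "st ?z (int L - span) = st u (- span)"
    using st_splice_le[of "int L - span" b ?y u] st_splice_le[of "int L - span" "a + int L" "translate (- int L) u" ?c]
      ab le by simp
  moreover have "st ?z 0 = st u 0" using st_splice_ge[OF 2 ab(3)] by simp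
  ultimately show ?thesis using False by (auto simp: shortening_def)
qed

lemma remove_cycle_final:
  assumes x: "x \<in> X" and t: "final x t"
  obtains z where "shortening (translate t x) z"
    "remove_cycle x = splice_at t (splice_at (t + int L - span) (translate (- int L) x) (translate (- t) z)) x"
    "remove_cycle x \<in> X"
proof -
  let ?z = "SOME z. shortening (translate t x) z"
  let ?y = "splice_at (t + int L - span) (translate (- int L) x) (translate (- t) ?z)"
  have M: "st x t \<in> M" using t by (simp add: final_def)
  have z: "shortening (translate t x) ?z"
    by (rule someI_ex[of "shortening (translate t x)"], rule shortening_exists) (use M x translate_in_X in auto)
  have eq: "remove_cycle x = splice_at t ?y x"
    using L_le_span[OF x]
    by (auto simp: fun_eq_iff remove_cycle_def splice_at_def final_live[OF t] final_time_eq[OF t])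
  have 1: "st (translate (- int L) x) (t + int L - span) = st (translate (- t) ?z) (t + int L - span)"
    using z by (simp add: shortening_def algebra_simps)
  have y: "?y \<in> X" using x z 1 by (intro splice_in_X translate_in_X) (auto simp: shortening_def)
  have 2: "st ?y t = st x t" using st_splice_ge[OF 1, of t] L_le_span[OF x] z by (simp add: shortening_def)
  show ?thesis using that[OF z eq] splice_in_X[OF y x 2] eq by simp
qed

lemma remove_cycle_dead: "x \<in> X \<Longrightarrow> (\<And>i. \<not> live x i) \<Longrightarrow> remove_cycle x = x"
  by (auto simp: remove_cycle_def)

lemma remove_cycle_live: "(\<And>i. live x i) \<Longrightarrow> remove_cycle x = translate (- int L) x"
  by (auto simp: remove_cycle_def)

text \<open>Insertion keeps the last visit and puts the cycle right before it, so every shortening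
  that may be chosen is the deletion of this cycle.\<close>

lemma remove_insert_cycle:
  assumes x: "x \<in> X"
  shows "remove_cycle (insert_cycle x) = x"
proof (rule live_cases[OF x])
  assume "\<And>i. \<not> live x i"
  then show ?thesis using x by (simp add: insert_cycle_dead remove_cycle_dead)
next
  assume "\<And>i. live x i"
  then show ?thesis by (simp add: insert_cycle_live remove_cycle_live live_translate)
next
  fix t assume t: "final x t"
  note p = insert_cycle_final_props[OF x t]
  let ?y = "insert_cycle x"
  obtain z where z: "shortening (translate t ?y) z"
    "remove_cycle ?y = splice_at t (splice_at (t + int L - span) (translate (- int L) ?y) (translate (- t) z)) ?y"
    using remove_cycle_final[OF p(1,2)] by metis
  have "ends_in_cycle (translate t ?y)"
    unfolding ends_in_cycle_def st_translate using p(3)[of "_ + t"] p(4) by auto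
  then have zi: "\<forall>i\<in>{int L - span<..0}. z i = ?y (i - int L + t)"
    using z(1) by (simp add: shortening_def)
  show ?thesis
  proof
    fix i
    consider "i > t" | "i \<le> t + int L - span" | "t + int L - span < i" "i \<le> t" by linarith
    then show "remove_cycle ?y i = x i"
    proof cases
      case 1 then show ?thesis unfolding z(2) by (simp add: splice_at_def p)
    next
      case 2 then show ?thesis unfolding z(2) using L_le_span[OF x] by (simp add: splice_at_def p(5))
    next
      case 3
      then have "remove_cycle ?y i = z (i - t)" unfolding z(2) by (simp add: splice_at_def)
      also have "\<dots> = ?y (i - int L)" using zi 3 by simp
      also have "\<dots> = x i" using 3 p(5)[of "i - int L"] by simp
      finally show ?thesis .
    qed
  qed
qed

section \<open>Equivariance and locality of the two maps\<close>

lemma final_time_translate: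
  assumes "live x (i + k)" "\<not> live x (j + k)"
  shows "final_time (translate k x) = final_time x - k"
proof -
  obtain t where "final x t" using final_between assms by metis
  then show ?thesis by (simp add: final_time_eq final_time_eq[OF final_translate])
qed

lemma insert_cycle_translate: "insert_cycle (translate k x) = translate k (insert_cycle x)"
proof
  fix i
  show "insert_cycle (translate k x) i = translate k (insert_cycle x) i"
  proof (cases "live x (i + k) \<and> \<not> live x (i + int L + k)")
    case True
    then have "final_time (translate k x) = final_time x - k" by (intro final_time_translate) auto
    moreover have "i + k - final_time x = i - (final_time x - k)" by simp
    ultimately show ?thesis using True
      by (simp only: insert_cycle_def live_translate st_translate translate_apply) (simp add: add_ac)
  next
    case False
    then show ?thesis by (auto simp: insert_cycle_def live_translate algebra_simps)
  qed
qed

lemma remove_cycle_translate: "remove_cycle (translate k x) = translate k (remove_cycle x)"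
proof
  fix i
  show "remove_cycle (translate k x) i = translate k (remove_cycle x) i"
  proof (cases "live x (i + k) \<and> \<not> live x (i + span - int L + k)")
    case True
    then have "final_time (translate k x) = final_time x - k" by (intro final_time_translate) auto
    moreover have "i + k - final_time x = i - (final_time x - k)"
      "i + k + span - int L = i + span - int L + k" by simp_all
    ultimately show ?thesis using True
      by (simp only: remove_cycle_def live_translate translate_apply translate_translate) simp
  next
    case False
    then show ?thesis by (auto simp: remove_cycle_def live_translate algebra_simps)
  qed
qed

text \<open>A state in \<open>M\<close> further ahead forces every earlier recurrent state to be in \<open>M\<close>, and recurrent
  states occur with bounded gaps; this makes \<open>live\<close> a local property.\<close>

lemma live_local:
  assumes x: "x \<in> X"
  shows "live x i \<longleftrightarrow> (\<exists>s\<in>{i..i + span}. st x s \<in> M)"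
proof
  assume "live x i"
  then obtain s where s: "s \<ge> i" "st x s \<in> M" by (auto simp: live_def)
  obtain a where a: "i \<le> a" "a \<le> i + int (card states)" "recurrent (st x a)"
    using recurrent_nearby[OF x] by metis
  have "int (card states) \<le> span" using L_pos by (simp add: span_def Suc_le_eq flip: of_nat_mult)
  then show "\<exists>s\<in>{i..i + span}. st x s \<in> M"
    using M_pred[OF x _ s(2) a(3)] a s
    by (cases "a \<le> s") (auto intro: bexI[of _ a] bexI[of _ s])
qed (auto simp: live_def)

lemma live_cong:
  assumes "x \<in> X" "y \<in> X" "\<And>j. i - int n \<le> j \<Longrightarrow> j \<le> i + span \<Longrightarrow> x j = y j"
  shows "live x i \<longleftrightarrow> live y i"
proof -
  have "st x s = st y s" if "s \<in> {i..i + span}" for s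
    using that by (intro st_cong assms(3)) auto
  then show ?thesis using assms by (simp add: live_local)
qed

text \<open>Agreement says nothing about times after \<open>j\<close>, so both points are required
  to be dead there; the last visit then lies in the window of agreement.\<close>

lemma final_time_cong:
  assumes "x \<in> X" "y \<in> X" "live x i" "\<not> live x j" "\<not> live y j"
    and agree: "\<And>k. i - int n \<le> k \<Longrightarrow> k \<le> j \<Longrightarrow> x k = y k"
  obtains t where "final_time x = t" "final_time y = t" "final x t" "i \<le> t" "t < j"
proof -
  obtain t where t: "final x t" "i \<le> t" "t < j" using final_between assms by metis
  have eq: "st x s = st y s" if "i \<le> s" "s \<le> j" for s
    using that by (intro st_cong agree) auto
  have "final y t"
    unfolding final_def
  proof (intro conjI allI impI)
    show "st y t \<in> M" using t eq[of t] by (simp add: final_def)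
    fix s assume "s > t"
    show "st y s \<notin> M"
    proof (cases "s < j")
      case True
      then show ?thesis using t eq[of s] \<open>s > t\<close> by (auto simp: final_def)
    next
      case False
      then show ?thesis using assms(5) by (auto simp: live_def)
    qed
  qed
  then show ?thesis using that t by (simp add: final_time_eq)
qed

lemma local_endo_insert_cycle: "local_endo X insert_cycle"
  unfolding local_endo_def
proof (intro conjI ballI allI exI impI)
  fix x assume x: "x \<in> X"
  show "insert_cycle x \<in> X"
    by (rule live_cases[OF x])
      (auto simp: insert_cycle_dead insert_cycle_live translate_in_X x insert_cycle_final_props)
next
  fix x k assume "x \<in> X"
  show "insert_cycle (translate k x) = translate k (insert_cycle x)" by (rule insert_cycle_translate)
next
  fix x y assume x: "x \<in> X" and y: "y \<in> X"
  \<comment> \<open>Testing \<open>live\<close> at \<open>0\<close> and \<open>L\<close> reads up to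
    \<open>L + span\<close>, at most \<open>2 * span\<close>; states reach \<open>n\<close> symbols
    back.\<close>
  let ?N = "2 * span + int L + int n"
  assume eq: "\<forall>j\<in>{- ?N..?N}. x j = y j"
  have sp: "int L \<le> span" by (rule L_le_span[OF x])
  have l: "live x i \<longleftrightarrow> live y i" if "0 \<le> i" "i \<le> span" for i
    using eq that sp by (intro live_cong x y) auto
  show "insert_cycle x 0 = insert_cycle y 0"
  proof (cases "live x 0 \<and> \<not> live x (int L)")
    case True
    obtain t where t: "final_time x = t" "final_time y = t" "final x t" "0 \<le> t" "t < int L"
      by (rule final_time_cong[OF x y, of 0 "int L"]) (use True l[of "int L"] eq sp in auto)
    have "st x t = st y t" using t eq sp by (intro st_cong) auto
    then show ?thesis using t l[of 0] l[of "int L"] True sp by (simp add: insert_cycle_def)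
  next
    case False
    have "x (int L) = y (int L)" "x 0 = y 0" using eq sp by auto
    then show ?thesis using False l[of 0] l[of "int L"] sp by (auto simp: insert_cycle_def)
  qed
qed

text \<open>The predicates themselves must coincide: only then does \<open>SOME\<close> choose the
  same path for both points, making \<open>remove_cycle\<close> local.\<close>

lemma shortening_cong:
  assumes "\<And>j. - span - int n - int L \<le> j \<Longrightarrow> j \<le> 0 \<Longrightarrow> u j = v j" "int L \<le> span"
  shows "shortening u = shortening v"
proof -
  have s: "st u j = st v j" if "- span \<le> j" "j \<le> 0" for j
    using that by (intro st_cong assms(1)) auto
  have c: "ends_in_cycle u \<longleftrightarrow> ends_in_cycle v"
    unfolding ends_in_cycle_def using s assms(2) by (intro ball_cong) auto
  have w: "u (i - int L) = v (i - int L)" if "i \<in> {int L - span<..0}" for i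
    using that by (intro assms(1)) auto
  show ?thesis
    unfolding shortening_def fun_eq_iff c using s[of 0] s[of "- span"] w assms(2) by auto
qed

lemma local_endo_remove_cycle: "local_endo X remove_cycle"
  unfolding local_endo_def
proof (intro conjI ballI allI exI impI)
  fix x assume x: "x \<in> X"
  show "remove_cycle x \<in> X"
  proof (rule live_cases[OF x])
    fix t assume "final x t"
    then show ?thesis using remove_cycle_final[OF x] by metis
  qed (auto simp: remove_cycle_dead remove_cycle_live translate_in_X x)
next
  fix x k assume "x \<in> X"
  show "remove_cycle (translate k x) = translate k (remove_cycle x)" by (rule remove_cycle_translate)
next
  fix x y assume x: "x \<in> X" and y: "y \<in> X"
  \<comment> \<open>The shortening reads back to \<open>span + n + L\<close> before the last visit,
    which lies between \<open>0\<close> and \<open>span - L\<close>.\<close>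
  let ?N = "3 * span + int L + int n"
  assume eq: "\<forall>j\<in>{- ?N..?N}. x j = y j"
  have sp: "int L \<le> span" by (rule L_le_span[OF x])
  have l: "live x i \<longleftrightarrow> live y i" if "0 \<le> i" "i \<le> span" for i
    using eq that sp by (intro live_cong x y) auto
  show "remove_cycle x 0 = remove_cycle y 0"
  proof (cases "live x 0 \<and> \<not> live x (span - int L)")
    case True
    obtain t where t: "final_time x = t" "final_time y = t" "final x t" "0 \<le> t" "t < span - int L"
      by (rule final_time_cong[OF x y, of 0 "span - int L"]) (use True l[of "span - int L"] eq sp in auto)
    have "shortening (translate t x) = shortening (translate t y)"
      using t eq sp by (intro shortening_cong) auto
    then show ?thesis using t l[of 0] l[of "span - int L"] True sp by (simp add: remove_cycle_def)
  next
    case False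
    have "x (- int L) = y (- int L)" "x 0 = y 0" using eq sp by auto
    then show ?thesis using False l[of 0] l[of "span - int L"] sp by (auto simp: remove_cycle_def)
  qed
qed

text \<open>\<open>insert_cycle\<close> has a left inverse and is therefore onto; an image with last
  visit \<open>t\<close> has the inserted cycle just before \<open>t\<close>.\<close>

lemma directly_finite_imp_final_cycle:
  assumes "directly_finite X" and y: "y \<in> X" and t: "final y t" and i: "t - int L < i" "i \<le> t"
  shows "y i = cyc (st y t) (i - t)"
proof -
  have "insert_cycle ` X = X"
    using assms(1) local_endo_insert_cycle local_endo_remove_cycle remove_insert_cycle
    unfolding directly_finite_def by blast
  then obtain x where x: "x \<in> X" "y = insert_cycle x" using y by blast
  show ?thesis
  proof (rule live_cases[OF x(1)])
    assume "\<And>i. \<not> live x i"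
    then show ?thesis using x(2) final_live[OF t, of t] by (simp add: insert_cycle_dead)
  next
    assume "\<And>i. live x i"
    then show ?thesis using x(2) final_live[OF t, of "t + 1"] by (simp add: insert_cycle_live live_translate)
  next
    fix s assume s: "final x s"
    note p = insert_cycle_final_props[OF x(1) s]
    \<comment> \<open>Insertion preserves the last visit, so the preimage has its last visit at the
      same time.\<close>
    have "s = t" using p(2) t x(2) by (metis final_time_eq)
    then show ?thesis using p(4,6) x(2) i by simp
  qed
qed

end

section \<open>One-sided determined states\<close>

context finite_type
begin

lemma recurrent_cycle:
  assumes "recurrent q"
  obtains l :: nat and c where "l > 0" "c \<in> X" "translate (int l) c = c" "st c 0 = q"
proof -
  obtain x i j where x: "x \<in> X" "i < j" "st x i = q" "st x j = q"
    using assms by (auto simp: recurrent_def)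
  have eq: "x (i - k) = x (i + (j - i) - k)" if "0 \<le> k" "k < int n" for k
    using x(3,4) that st_eq_iff[of x i x j] by auto
  obtain c where c: "c \<in> X" "translate (j - i) c = c" "\<And>k. - int n < k \<Longrightarrow> k \<le> j - i \<Longrightarrow> c k = x (i + k)"
    using periodic_closing[OF x(1) _ order_refl eq] x(2) by (metis diff_gt_0_iff_gt)
  have "st c 0 = st x i" unfolding st_eq_iff using c(3) x(2) by auto
  then show ?thesis using that[of "nat (j - i)" c] c x by simp
qed

lemma recurrent_in_states: "recurrent q \<Longrightarrow> q \<in> states"
  by (auto simp: recurrent_def st_in_states)

text \<open>Finitely many states are recurrent, so the product of their individual periods serves
  them all.\<close>

lemma common_period:
  obtains L :: nat where "L > 0" "\<And>q. recurrent q \<Longrightarrow> \<exists>c\<in>X. translate (int L) c = c \<and> st c 0 = q"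
proof -
  have "\<exists>l. recurrent q \<longrightarrow> l > 0 \<and> (\<exists>c\<in>X. translate (int l) c = c \<and> st c 0 = q)" for q
    using recurrent_cycle by metis
  then obtain l where l: "\<And>q. recurrent q \<Longrightarrow> l q > 0"
    "\<And>q. recurrent q \<Longrightarrow> \<exists>c\<in>X. translate (int (l q)) c = c \<and> st c 0 = q" by metis
  let ?R = "Collect recurrent"
  have fin: "finite ?R" using recurrent_in_states finite_states by (auto intro: finite_subset)
  show ?thesis
  proof
    show "prod l ?R > 0" using l(1) by (auto intro!: prod_pos)
    fix q assume q: "recurrent q"
    then obtain c where c: "c \<in> X" "translate (int (l q)) c = c" "st c 0 = q" using l(2) by blast
    have "l q dvd prod l ?R" using fin q by (intro dvd_prodI) auto
    then obtain m where "prod l ?R = l q * m" by (auto simp: dvd_def)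
    then have "translate (int (prod l ?R)) c = c" using translate_multiple[OF c(2), of "int m"]
      by (simp only: of_nat_mult)
    then show "\<exists>c\<in>X. translate (int (prod l ?R)) c = c \<and> st c 0 = q" using c by blast
  qed
qed

text \<open>Both rays end at a last visit in the same state, so each ends in the same cycle; any
  multiple of the common period may be inserted, and a long one reaches back to
  \<open>i\<close>.\<close>

lemma left_rays_agree:
  assumes df: "directly_finite X" and M_rec: "\<And>q. q \<in> M \<Longrightarrow> recurrent q"
    and M_pred: "\<And>x s t. x \<in> X \<Longrightarrow> s \<le> t \<Longrightarrow> st x t \<in> M \<Longrightarrow> recurrent (st x s) \<Longrightarrow> st x s \<in> M"
    and y: "y \<in> X" "st y 0 \<in> M" "\<And>s. s > 0 \<Longrightarrow> st y s \<notin> M"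
    and z: "z \<in> X" "st z 0 = st y 0" "\<And>s. s > 0 \<Longrightarrow> st z s \<notin> M"
    and i: "i \<le> 0"
  shows "y i = z i"
proof -
  obtain L0 :: nat where L0: "L0 > 0" "\<And>q. recurrent q \<Longrightarrow> \<exists>c\<in>X. translate (int L0) c = c \<and> st c 0 = q"
    by (rule common_period) blast
  then obtain cyc where cyc: "\<And>q. recurrent q \<Longrightarrow> cyc q \<in> X \<and> translate (int L0) (cyc q) = cyc q \<and> st (cyc q) 0 = q"
    by metis
  \<comment> \<open>The factor makes \<open>L\<close> exceed \<open>- i\<close>, so that position
    \<open>i\<close> falls inside the inserted cycle.\<close>
  define L where "L = L0 * Suc (nat (- i))"
  have per: "translate (int L) (cyc q) = cyc q" if "recurrent q" for q
    using translate_multiple[of "int L0" "cyc q" "int (Suc (nat (- i)))"] cyc[OF that]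
    unfolding L_def of_nat_mult by blast
  interpret cycle_insertion A n S X M L cyc
  proof
    show "L > 0" using L0 by (simp add: L_def)
  qed (use cyc per M_rec M_pred in auto)
  have "Suc (nat (- i)) \<le> L" using mult_le_mono1[of 1 L0 "Suc (nat (- i))"] L0(1) by (simp add: L_def)
  then have "- int L < i" using i by linarith
  moreover have "final y 0" "final z 0" using y z by (auto simp: final_def)
  ultimately show ?thesis
    using directly_finite_imp_final_cycle[OF df y(1), of 0 i] directly_finite_imp_final_cycle[OF df z(1), of 0 i]
      i z(2) by simp
qed

text \<open>Time \<open>s\<close> itself belongs to the left ray and not to the right one, the same
  cut as in \<open>splice_at\<close>.\<close>

definition left_determined :: "'a list \<Rightarrow> bool" where
  "left_determined q \<longleftrightarrow> (\<forall>x\<in>X. \<forall>y\<in>X. \<forall>s t. st x s = q \<and> st y t = q \<longrightarrow> (\<forall>j\<le>0. x (s + j) = y (t + j)))"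

definition right_determined :: "'a list \<Rightarrow> bool" where
  "right_determined q \<longleftrightarrow> (\<forall>x\<in>X. \<forall>y\<in>X. \<forall>s t. st x s = q \<and> st y t = q \<longrightarrow> (\<forall>j>0. x (s + j) = y (t + j)))"

lemma left_determinedD:
  "left_determined q \<Longrightarrow> x \<in> X \<Longrightarrow> y \<in> X \<Longrightarrow> st x s = q \<Longrightarrow> st y t = q \<Longrightarrow> j \<le> 0 \<Longrightarrow> x (s + j) = y (t + j)"
  unfolding left_determined_def by blast

lemma right_determinedD:
  "right_determined q \<Longrightarrow> x \<in> X \<Longrightarrow> y \<in> X \<Longrightarrow> st x s = q \<Longrightarrow> st y t = q \<Longrightarrow> j > 0 \<Longrightarrow> x (s + j) = y (t + j)"
  unfolding right_determined_def by blast

text \<open>Take for \<open>M\<close> the recurrent states that reach \<open>st w k\<close>;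
  \<open>w\<close> leaves them for good before \<open>b\<close>. Any past leading to
  \<open>st w k\<close> can be continued by \<open>w\<close>, giving the same last visit, and
  \<open>left_rays_agree\<close> applies.\<close>

lemma exit_left_determined:
  assumes df: "directly_finite X" and w: "w \<in> X" and rec: "recurrent (st w k)"
    and kb: "k < b" and nr: "\<not> reach (st w b) (st w k)"
  shows "left_determined (st w k)"
proof -
  let ?M = "{q. recurrent q \<and> reach q (st w k)}"
  have kM: "st w k \<in> ?M" using rec reachI[OF w, of k k] by simp
  \<comment> \<open>A visit to \<open>M\<close> at or after \<open>b\<close> would lead from
    \<open>st w b\<close> back to \<open>st w k\<close>.\<close>
  have bd: "s < b" if "st w s \<in> ?M" for s
    using that nr reach_trans[OF reachI[OF w, of b s], of "st w k"] by force
  let ?R = "{s \<in> {k..b}. st w s \<in> ?M}"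
  have fin: "finite ?R" by (rule finite_subset[of _ "{k..b}"]) auto
  have ne: "?R \<noteq> {}" using kM kb by auto
  define t where "t = Max ?R"
  have t: "t \<in> ?R" unfolding t_def using fin ne by (rule Max_in)
  have after: "st w s \<notin> ?M" if "s > t" for s
  proof
    assume s: "st w s \<in> ?M"
    then have "s \<in> ?R" using bd[OF s] t that by auto
    then have "s \<le> t" unfolding t_def using fin by (intro Max_ge)
    then show False using that by simp
  qed
  have main: "x (s + j) = w (k + j)" if x: "x \<in> X" "st x s = st w k" and j: "j \<le> 0" for x s j
  proof -
    obtain z where z: "z \<in> X" "\<And>m. m \<le> s \<Longrightarrow> z m = x m" "\<And>m. m \<ge> s \<Longrightarrow> st z m = st w (m + (k - s))"
      using path_append[OF x(1) w order_refl order_refl x(2)] by metis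
    \<comment> \<open>Both paths are translated so that their common last visit to \<open>M\<close>
      is at time \<open>0\<close>; time \<open>k\<close> of \<open>w\<close> becomes
      \<open>k - t\<close>, which is at most \<open>0\<close>.\<close>
    let ?y = "translate t w" and ?z = "translate (t + s - k) z"
    have zs: "st ?z m = st w (m + t)" if "m \<ge> 0" for m
      using z(3)[of "m + (t + s - k)"] that t by (simp add: algebra_simps)
    have "?y (k - t + j) = ?z (k - t + j)"
    proof (rule left_rays_agree[OF df, of ?M ?y ?z])
      show "x \<in> X \<Longrightarrow> s \<le> t \<Longrightarrow> st x t \<in> ?M \<Longrightarrow> recurrent (st x s) \<Longrightarrow> st x s \<in> ?M" for x s t
        using reachI[of x s t] reach_trans by blast
      show "st ?z s \<notin> ?M" if "s > 0" for s using zs[of s] after[of "s + t"] that by simp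
      show "st ?y s \<notin> ?M" if "s > 0" for s using after[of "s + t"] that by simp
      show "st ?y 0 \<in> ?M" using t by simp
      show "st ?z 0 = st ?y 0" using zs[of 0] by simp
    qed (use t w z j in \<open>auto simp: translate_in_X simp del: translate_apply\<close>)
    then show ?thesis using z(2)[of "s + j"] j by (simp add: algebra_simps)
  qed
  show ?thesis unfolding left_determined_def using main by metis
qed

section \<open>Reflection of time\<close>

definition reflect :: "(int \<Rightarrow> 'a) \<Rightarrow> int \<Rightarrow> 'a" where
  "reflect x = (\<lambda>i. x (1 - int n - i))"

lemma reflect_reflect [simp]: "reflect (reflect x) = x"
  by (auto simp: reflect_def)

lemma reflect_translate: "reflect (translate k x) = translate (- k) (reflect x)"
  by (auto simp: reflect_def fun_eq_iff algebra_simps)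

text \<open>The offset \<open>1 - int n\<close> sends the block of \<open>n\<close> positions ending
  at \<open>i\<close> to the block ending at \<open>- i\<close>. Words get reversed, so only
  equality of states is transported.\<close>

lemma st_reflect_eq_iff: "st (reflect x) i = st (reflect y) j \<longleftrightarrow> st x (- i) = st y (- j)"
proof -
  have imp: "st (reflect x) i = st (reflect y) j" if eq: "st x (- i) = st y (- j)" for x y i j
    unfolding st_eq_iff
  proof (intro allI impI)
    fix k assume "0 \<le> k \<and> k < int n"
    then have "x (- i - (int n - 1 - k)) = y (- j - (int n - 1 - k))"
      by (intro eq[unfolded st_eq_iff, rule_format]) auto
    then show "reflect x (i - k) = reflect y (j - k)" by (simp add: reflect_def algebra_simps)
  qed
  show ?thesis using imp[of x i y j] imp[of "reflect x" "- i" "reflect y" "- j"] by auto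
qed

text \<open>The allowed words are the states of the reflected points instead of reversals of
  \<open>S\<close>, so membership in \<open>X\<close> is recovered by comparing states with those of
  actual points.\<close>

lemma finite_type_reflect: "finite_type A n {st x i |x i. x \<in> reflect ` X} (reflect ` X)"
proof
  have "x \<in> reflect ` X" if r: "range x \<subseteq> A" and s: "\<And>i. window x i n \<in> {st x i |x i. x \<in> reflect ` X}" for x
  proof -
    have "reflect x \<in> X"
      unfolding X_iff
    proof
      show "range (reflect x) \<subseteq> A" using r by (auto simp: reflect_def)
      show "\<forall>i. st (reflect x) i \<in> S"
      proof
        fix i
        have "st x (- i) \<in> {st x i |x i. x \<in> reflect ` X}" unfolding st_def[of x] by (rule s)
        then obtain y j where y: "y \<in> X" "st x (- i) = st (reflect y) j" by auto
        then have "st (reflect x) i = st y (- j)" using st_reflect_eq_iff[of x i "reflect y" "- j"] by simp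
        then show "st (reflect x) i \<in> S" using y(1) by (simp add: X_iff)
      qed
    qed
    then show ?thesis using reflect_reflect by (metis imageI)
  qed
  moreover have "range (reflect x) \<subseteq> A" if "x \<in> X" for x using that by (auto simp: X_iff reflect_def)
  moreover have "window (reflect x) i n \<in> {st x i |x i. x \<in> reflect ` X}" if "x \<in> X" for x i
    using that by (auto simp: st_def intro!: exI[of _ "reflect x"] exI[of _ "i + int n"])
  ultimately show "reflect ` X = {x. range x \<subseteq> A \<and> (\<forall>i. window x i n \<in> {st x i |x i. x \<in> reflect ` X})}"
    by blast
qed (rule finite_alphabet)

lemma local_endo_reflect:
  assumes \<tau>: "local_endo (reflect ` X) \<tau>"
  shows "local_endo X (\<lambda>x. reflect (\<tau> (reflect x)))"
proof -
  have closed: "reflect (\<tau> (reflect x)) \<in> X" if "x \<in> X" for x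
  proof -
    have "\<tau> (reflect x) \<in> reflect ` X" using \<tau> that unfolding local_endo_def by blast
    then show ?thesis by auto
  qed
  have tr: "\<tau> (translate k (reflect x)) = translate k (\<tau> (reflect x))" if "x \<in> X" for x k
    using \<tau> that unfolding local_endo_def by blast
  have tr': "reflect (\<tau> (reflect (translate k x))) = translate k (reflect (\<tau> (reflect x)))"
    if "x \<in> X" for x k
    using tr[OF that, of "- k"] by (simp only: reflect_translate minus_minus)
  obtain N where N: "\<forall>x\<in>reflect ` X. \<forall>y\<in>reflect ` X. (\<forall>j\<in>{-N..N}. x j = y j) \<longrightarrow> \<tau> x 0 = \<tau> y 0"
    using \<tau> unfolding local_endo_def by blast
  \<comment> \<open>\<open>reflect\<close> reads coordinate \<open>1 - int n\<close> at
    \<open>0\<close>; translating by \<open>?k\<close> cancels this, since the translated reflection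
    is \<open>x (- j)\<close> at \<open>j\<close>.\<close>
  let ?k = "1 - int n"
  have mem: "translate ?k (reflect x) \<in> reflect ` X" if "x \<in> X" for x
  proof (rule image_eqI)
    show "translate ?k (reflect x) = reflect (translate (- ?k) x)"
      by (simp only: reflect_translate minus_minus)
  qed (rule translate_in_X[OF that])
  have loc: "reflect (\<tau> (reflect x)) 0 = reflect (\<tau> (reflect y)) 0"
    if x: "x \<in> X" and y: "y \<in> X"
      and eq: "\<forall>j\<in>{- (N + 2 * int n + 2)..N + 2 * int n + 2}. x j = y j" for x y
  proof -
    have "translate ?k (reflect x) j = translate ?k (reflect y) j" if "j \<in> {- N..N}" for j
      using eq that by (auto simp: reflect_def)
    then have "\<tau> (translate ?k (reflect x)) 0 = \<tau> (translate ?k (reflect y)) 0"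
      using N mem[OF x] mem[OF y] by blast
    then show ?thesis unfolding tr[OF x] tr[OF y] by (simp add: reflect_def)
  qed
  show ?thesis unfolding local_endo_def using closed tr' loc by blast
qed

lemma directly_finite_reflect:
  assumes "directly_finite X"
  shows "directly_finite (reflect ` X)"
  unfolding directly_finite_def
proof (intro allI impI)
  fix \<rho> \<tau>
  assume *: "local_endo (reflect ` X) \<rho> \<and> local_endo (reflect ` X) \<tau> \<and> (\<forall>x\<in>reflect ` X. \<rho> (\<tau> x) = x)"
  let ?r = "\<lambda>x. reflect (\<rho> (reflect x))" and ?t = "\<lambda>x. reflect (\<tau> (reflect x))"
  have "local_endo X ?r" "local_endo X ?t" using * local_endo_reflect by blast+
  moreover have "\<forall>x\<in>X. ?r (?t x) = x" using * by simp
  ultimately have "?t ` X = X" using assms unfolding directly_finite_def by blast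
  then have "reflect ` ?t ` X = reflect ` X" by simp
  then show "\<tau> ` reflect ` X = reflect ` X" by (simp add: image_image)
qed

text \<open>Reflection reverses reachability, turning the entrance into an exit of the reflected
  shift.\<close>

lemma entrance_right_determined:
  assumes df: "directly_finite X" and w: "w \<in> X" and rec: "recurrent (st w k)"
    and ak: "a < k" and nr: "\<not> reach (st w k) (st w a)"
  shows "right_determined (st w k)"
proof -
  interpret R: finite_type A n "{st x i |x i. x \<in> reflect ` X}" "reflect ` X"
    by (rule finite_type_reflect)
  obtain x i j where x: "x \<in> X" "i < j" "st x i = st w k" "st x j = st w k"
    using rec by (auto simp: recurrent_def)
  have e: "st (reflect x) (- j) = st (reflect w) (- k)" "st (reflect x) (- i) = st (reflect w) (- k)"
    using x by (simp_all add: st_reflect_eq_iff)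
  have 1: "R.recurrent (st (reflect w) (- k))"
    using R.recurrentI[of "reflect x" "- j" "- i"] e x by simp
  have 2: "\<not> R.reach (st (reflect w) (- a)) (st (reflect w) (- k))"
  proof
    assume "R.reach (st (reflect w) (- a)) (st (reflect w) (- k))"
    then obtain z c d where z: "z \<in> X" "c \<le> d" "st (reflect z) c = st (reflect w) (- a)"
      "st (reflect z) d = st (reflect w) (- k)" by (auto simp: R.reach_def)
    then have "st z (- c) = st w a" "st z (- d) = st w k" by (simp_all add: st_reflect_eq_iff)
    then show False using nr reachI[OF z(1), of "- d" "- c"] z(2) by simp
  qed
  have L: "R.left_determined (st (reflect w) (- k))"
    using directly_finite_reflect[OF df] _ 1 _ 2 by (rule R.exit_left_determined) (use w ak in auto)
  show ?thesis
    unfolding right_determined_def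
  proof (intro ballI allI impI)
    fix x y s t j assume *: "x \<in> X" "y \<in> X" "st x s = st w k \<and> st y t = st w k" and j: "(j :: int) > 0"
    \<comment> \<open>The index \<open>1 - int n - j\<close> is at most \<open>0\<close> and
      reflects to the position \<open>j\<close> steps after the state.\<close>
    have "reflect x (- s + (1 - int n - j)) = reflect y (- t + (1 - int n - j))"
    proof (rule R.left_determinedD[OF L])
      show "st (reflect x) (- s) = st (reflect w) (- k)" "st (reflect y) (- t) = st (reflect w) (- k)"
        using * by (simp_all add: st_reflect_eq_iff)
    qed (use * j in auto)
    then show "x (s + j) = y (t + j)" by (simp add: reflect_def algebra_simps)
  qed
qed

text \<open>Two pasts of \<open>u\<close> extended by one common path to \<open>v\<close> become
  pasts of \<open>v\<close>, where they must coincide.\<close>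

lemma left_determined_reach:
  assumes "reach u v" "left_determined v"
  shows "left_determined u"
  unfolding left_determined_def
proof (intro ballI allI impI)
  fix x y s t j assume x: "x \<in> X" and y: "y \<in> X" and st: "st x s = u \<and> st y t = u" and j: "j \<le> (0 :: int)"
  obtain z a b where z: "z \<in> X" "a \<le> b" "st z a = u" "st z b = v" using assms(1) by (auto simp: reach_def)
  have eq: "st x s = st z a" "st y t = st z a" using z st by auto
  obtain x' where x': "x' \<in> X" "st x' (s + (b - a)) = st z b" "\<And>m. m \<le> s \<Longrightarrow> x' m = x m"
    by (rule path_append[OF x z(1) order_refl z(2) eq(1)]) blast
  obtain y' where y': "y' \<in> X" "st y' (t + (b - a)) = st z b" "\<And>m. m \<le> t \<Longrightarrow> y' m = y m"
    by (rule path_append[OF y z(1) order_refl z(2) eq(2)]) blast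
  have "x' (s + (b - a) + (j - (b - a))) = y' (t + (b - a) + (j - (b - a)))"
    using x' y' z j by (intro left_determinedD[OF assms(2)]) auto
  then show "x (s + j) = y (t + j)" using x'(3)[of "s + j"] y'(3)[of "t + j"] j by simp
qed

text \<open>Two futures of \<open>v\<close> preceded by one common path from \<open>u\<close> become
  futures of \<open>u\<close>.\<close>

lemma right_determined_reach:
  assumes "reach u v" "right_determined u"
  shows "right_determined v"
  unfolding right_determined_def
proof (intro ballI allI impI)
  fix x y s t j assume x: "x \<in> X" and y: "y \<in> X" and st: "st x s = v \<and> st y t = v" and j: "j > (0 :: int)"
  obtain z a b where z: "z \<in> X" "a \<le> b" "st z a = u" "st z b = v" using assms(1) by (auto simp: reach_def)
  have eq: "st z b = st x s" "st z b = st y t" using z st by auto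
  obtain x' where x': "x' \<in> X" "st x' a = st z a" "\<And>m. m > b \<Longrightarrow> x' m = x (m + (s - b))"
    by (rule path_append[OF z(1) x z(2) order_refl eq(1)]) blast
  obtain y' where y': "y' \<in> X" "st y' a = st z a" "\<And>m. m > b \<Longrightarrow> y' m = y (m + (t - b))"
    by (rule path_append[OF z(1) y z(2) order_refl eq(2)]) blast
  have "x' (a + (b - a + j)) = y' (a + (b - a + j))"
    using x' y' z j by (intro right_determinedD[OF assms(2)]) auto
  then show "x (s + j) = y (t + j)" using x'(3)[of "b + j"] y'(3)[of "b + j"] j by (simp add: add_ac)
qed

section \<open>Wandering points\<close>

text \<open>The path passes irreversibly from one strongly connected component of the state graph to
  another.\<close>

definition wandering :: "(int \<Rightarrow> 'a) \<Rightarrow> bool" where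
  "wandering x \<longleftrightarrow> (\<exists>a b. a < b \<and> \<not> reach (st x b) (st x a))"

definition wandering_states :: "'a list set" where
  "wandering_states = {st w k |w k. w \<in> X \<and> wandering w}"

text \<open>Defined through states and not as the set of wandering points, so as to be of finite
  type; it thereby also contains all limits of wandering points.\<close>

definition wandering_part :: "(int \<Rightarrow> 'a) set" where
  "wandering_part = {x \<in> X. \<forall>i. st x i \<in> wandering_states}"

definition recurrent_part :: "(int \<Rightarrow> 'a) set" where
  "recurrent_part = {x \<in> X. \<forall>i. st x i \<notin> wandering_states}"

lemma not_wandering_reach: "x \<in> X \<Longrightarrow> \<not> wandering x \<Longrightarrow> reach (st x i) (st x j)"
  using reachI[of x i j] by (cases "i \<le> j") (auto simp: wandering_def)

text \<open>A detour through \<open>st x j\<close> can be inserted into a wandering point without destroying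
  its wandering behaviour.\<close>

lemma wandering_states_spread:
  assumes x: "x \<in> X" and i: "st x i \<in> wandering_states"
  shows "st x j \<in> wandering_states"
proof (cases "wandering x")
  case True then show ?thesis using x by (auto simp: wandering_states_def)
next
  case False
  obtain w k where w: "w \<in> X" "wandering w" "st w k = st x i" using i by (force simp: wandering_states_def)
  obtain a b where ab: "a < b" "\<not> reach (st w b) (st w a)" using w(2) by (auto simp: wandering_def)
  obtain z1 c1 d1 where z1: "z1 \<in> X" "c1 \<le> d1" "st z1 c1 = st w k" "st z1 d1 = st x j"
    using not_wandering_reach[OF x False, of i j] w by (auto simp: reach_def)
  obtain z2 c2 d2 where z2: "z2 \<in> X" "c2 \<le> d2" "st z2 c2 = st x j" "st z2 d2 = st w k"
    using not_wandering_reach[OF x False, of j i] w by (auto simp: reach_def)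
  \<comment> \<open>\<open>l\<close> steps lead from \<open>st x i\<close> to \<open>st x j\<close>,
    and \<open>l'\<close> steps complete the round trip.\<close>
  define l where "l = d1 - c1"
  define l' where "l' = l + (d2 - c2)"
  have l: "0 \<le> l" "l \<le> l'" using z1 z2 by (auto simp: l_def l'_def)
  have "st w k = st z1 c1" using z1 by simp
  then obtain p1 where p1: "p1 \<in> X" "st p1 (k + l) = st z1 d1" "\<And>m. m \<le> k \<Longrightarrow> st p1 m = st w m"
    unfolding l_def by (rule path_append[OF w(1) z1(1) order_refl z1(2)]) blast
  have "st p1 (k + l) = st z2 c2" using p1 z1 z2 by simp
  then obtain p2 where p2: "p2 \<in> X" "st p2 (k + l + (d2 - c2)) = st z2 d2" "\<And>m. m \<le> k + l \<Longrightarrow> st p2 m = st p1 m"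
    by (rule path_append[OF p1(1) z2(1) order_refl z2(2)]) blast
  have "st p2 (k + l') = st w k" using p2 z2 by (simp add: l'_def algebra_simps)
  then obtain p where p: "p \<in> X" "\<And>m. m \<le> k + l' \<Longrightarrow> st p m = st p2 m"
    "\<And>m. m \<ge> k + l' \<Longrightarrow> st p m = st w (m + (k - (k + l')))"
    by (rule path_append[OF p2(1) w(1) order_refl order_refl]) blast
  have before: "st p m = st w m" if "m \<le> k" for m using p(2)[of m] p2(3)[of m] p1(3)[of m] l that by simp
  have after: "st p (m + l') = st w m" if "m \<ge> k" for m using p(3)[of "m + l'"] that by simp
  \<comment> \<open>Times after \<open>k\<close> are delayed by the round trip, so the unreachable
    pair of states survives in the same order.\<close>
  let ?a = "if a \<le> k then a else a + l'" and ?b = "if b \<le> k then b else b + l'"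
  have "?a < ?b" "st p ?a = st w a" "st p ?b = st w b" using ab l before after by auto
  then have "wandering p" using ab unfolding wandering_def by metis
  moreover have "st p (k + l) = st x j" using p(2)[of "k + l"] p2(3)[of "k + l"] p1(2) z1 l by simp
  ultimately show ?thesis using p(1) by (auto simp: wandering_states_def intro!: exI[of _ p] exI[of _ "k + l"])
qed

lemma parts_cover: "X = recurrent_part \<union> wandering_part"
  using wandering_states_spread by (auto simp: recurrent_part_def wandering_part_def)

lemma parts_disjoint: "recurrent_part \<inter> wandering_part = {}"
  by (auto simp: recurrent_part_def wandering_part_def)

text \<open>After following \<open>x\<close> to \<open>j\<close>, a path leads back to
  \<open>st x i\<close>, from where \<open>x\<close> is replayed with delay \<open>p\<close>. This
  is the return that non-wandering asks for.\<close>

lemma recurrent_part_return: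
  assumes x: "x \<in> recurrent_part" and ij: "i < j"
  obtains z p where "z \<in> recurrent_part" "p > 0" "\<And>m. m \<le> j \<Longrightarrow> z m = x m" "\<And>m. m > i \<Longrightarrow> z (m + p) = x m"
proof -
  have X: "x \<in> X" and nw: "\<And>k. st x k \<notin> wandering_states" using x by (auto simp: recurrent_part_def)
  then have "\<not> wandering x" by (auto simp: wandering_states_def)
  then obtain y c d where y: "y \<in> X" "c \<le> d" "st y c = st x j" "st y d = st x i"
    using not_wandering_reach[OF X, of j i] by (auto simp: reach_def)
  have "st x j = st y c" using y by simp
  then obtain q where q: "q \<in> X" "st q (j + (d - c)) = st y d" "\<And>m. m \<le> j \<Longrightarrow> st q m = st x m"
      "\<And>m. m \<le> j \<Longrightarrow> q m = x m"
    by (rule path_append[OF X y(1) order_refl y(2)]) blast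
  have "st q (j + (d - c)) = st x i" using q y by simp
  then obtain z where z: "z \<in> X" "\<And>m. m \<le> j + (d - c) \<Longrightarrow> st z m = st q m"
      "\<And>m. m \<le> j + (d - c) \<Longrightarrow> z m = q m" "\<And>m. m > j + (d - c) \<Longrightarrow> z m = x (m + (i - (j + (d - c))))"
    by (rule path_append[OF q(1) X order_refl order_refl]) blast
  \<comment> \<open>One state outside \<open>wandering_states\<close> suffices to place
    \<open>z\<close> in the recurrent part.\<close>
  have "st z j = st x j" using z(2)[of j] q(3)[of j] y by simp
  then have "z \<notin> wandering_part" using nw[of j] by (metis (mono_tags, lifting) mem_Collect_eq wandering_part_def)
  then have "z \<in> recurrent_part" using z(1) parts_cover by blast
  then show ?thesis
  proof (rule that[of z "j + (d - c) - i"])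
    show "z m = x m" if "m \<le> j" for m using z(3)[of m] q(4)[of m] that y by simp
    show "z (m + (j + (d - c) - i)) = x m" if "m > i" for m
      using z(4)[of "m + (j + (d - c) - i)"] that by simp
  qed (use ij y in auto)
qed

text \<open>The periodic point \<open>c\<close> passes through the same state, so its left ray is
  the only one possible.\<close>

lemma left_determined_periodic:
  assumes "left_determined (st x t)" "x \<in> X" "c \<in> X" "translate L c = c" "st c 0 = st x t" "j \<le> t"
    and L: "L \<ge> 0"
  shows "x (j - L) = x j"
proof -
  have d: "x (t + k) = c (0 + k)" if "k \<le> 0" for k
    using assms(1,2,3) refl assms(5) that by (rule left_determinedD)
  have "x j = c (j - t)" "x (j - L) = c (j - L - t)"
    using d[of "j - t"] d[of "j - L - t"] assms(6) L by auto
  moreover have "c (j - L - t) = c (j - t)" using fun_cong[OF assms(4), of "j - L - t"] by simp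
  ultimately show ?thesis by simp
qed

lemma right_determined_periodic:
  assumes "right_determined (st x t)" "x \<in> X" "c \<in> X" "translate L c = c" "st c 0 = st x t" "j > t"
    and L: "L \<ge> 0"
  shows "x (j + L) = x j"
proof -
  have d: "x (t + k) = c (0 + k)" if "k > 0" for k
    using assms(1,2,3) refl assms(5) that by (rule right_determinedD)
  have "x j = c (j - t)" "x (j + L) = c (j + L - t)"
    using d[of "j - t"] d[of "j + L - t"] assms(6) L by auto
  moreover have "c (j + L - t) = c (j - t)" using fun_cong[OF assms(4), of "j - t"] by (simp add: algebra_simps)
  ultimately show ?thesis by simp
qed

text \<open>If \<open>st w b\<close> reaches \<open>st w k\<close>, then \<open>st w k\<close>
  cannot reach \<open>st w a\<close>: the state lies before an exit or after an entrance.\<close>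

lemma wandering_determined:
  assumes df: "directly_finite X" and w: "w \<in> X" "wandering w" and rec: "recurrent (st w k)"
  shows "left_determined (st w k) \<or> right_determined (st w k)"
proof -
  obtain a b where ab: "a < b" "\<not> reach (st w b) (st w a)" using w(2) by (auto simp: wandering_def)
  show ?thesis
  proof (cases "reach (st w b) (st w k)")
    case False
    then have "k < b" using reachI[OF w(1), of b k] by force
    then show ?thesis using exit_left_determined[OF df w(1) rec _ False] by blast
  next
    case True
    then have nr: "\<not> reach (st w k) (st w a)" using ab reach_trans by blast
    then have "a < k" using reachI[OF w(1), of k a] by force
    then show ?thesis using entrance_right_determined[OF df w(1) rec _ nr] by blast
  qed
qed

text \<open>Left-determined times form an initial segment, nonempty and not everything;
  \<open>t\<close> is its end. Soon after \<open>t\<close> comes a recurrent state, which must be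
  right-determined, so only a block of bounded length remains free.\<close>

lemma wandering_core:
  assumes df: "directly_finite X" and w: "w \<in> X" "wandering w"
  obtains t where "left_determined (st w t)" "right_determined (st w (t + 1 + int (card states)))"
proof -
  obtain a b where ab: "a < b" "\<not> reach (st w b) (st w a)" using w(2) by (auto simp: wandering_def)
  \<comment> \<open>Searching from \<open>card states\<close> steps before \<open>a\<close> finds a
    recurrent state no later than \<open>a\<close>; \<open>st w b\<close> cannot reach it.\<close>
  obtain k where k: "a - int (card states) \<le> k" "k \<le> a" "recurrent (st w k)"
    using recurrent_nearby[OF w(1), of "a - int (card states)"] by auto
  have "\<not> reach (st w b) (st w k)" using ab(2) reach_trans[OF _ reachI[OF w(1) k(2)]] by blast
  then have Lk: "left_determined (st w k)" using exit_left_determined[OF df w(1) k(3)] k ab by force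
  have earlier: "left_determined (st w i)" if "left_determined (st w j)" "i \<le> j" for i j
    using left_determined_reach[OF reachI[OF w(1) that(2)] that(1)] .
  \<comment> \<open>Otherwise every coordinate lies on the left ray of a left-determined recurrent
    state, so \<open>w\<close> has period \<open>L\<close> and \<open>st w a\<close> reappears at or
    after \<open>b\<close>.\<close>
  have "\<exists>m. \<not> left_determined (st w m)"
  proof (rule ccontr)
    assume "\<not> ?thesis"
    then have all: "\<And>m. left_determined (st w m)" by blast
    obtain L :: nat where L: "L > 0" "\<And>q. recurrent q \<Longrightarrow> \<exists>c\<in>X. translate (int L) c = c \<and> st c 0 = q"
      by (rule common_period) blast
    have step: "w (j - int L) = w j" for j
    proof -
      obtain r where r: "j \<le> r" "recurrent (st w r)" using recurrent_nearby[OF w(1), of j] by metis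
      then obtain c where "c \<in> X" "translate (int L) c = c" "st c 0 = st w r" using L(2) by blast
      then show ?thesis using left_determined_periodic[OF all[of r] w(1), of c "int L" j] r by simp
    qed
    have per: "translate (int L) w = w"
    proof
      show "translate (int L) w j = w j" for j using step[of "j + int L"] by simp
    qed
    have "translate (int L * (b - a)) w = w" using per by (rule translate_multiple)
    then have ret: "st w a = st w (a + int L * (b - a))" by (metis st_translate)
    have "1 * (b - a) \<le> int L * (b - a)" using L(1) ab(1) by (intro mult_right_mono) auto
    then have "b \<le> a + int L * (b - a)" unfolding mult_1 diff_le_eq by (simp only: add.commute)
    with ret show False using ab(2) reachI[OF w(1), of b "a + int L * (b - a)"] by simp
  qed
  then obtain m where m: "\<not> left_determined (st w m)" by blast
  let ?R = "{s \<in> {k..m}. left_determined (st w s)}"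
  have fin: "finite ?R" by (rule finite_subset[of _ "{k..m}"]) auto
  have bd: "s < m" if "left_determined (st w s)" for s using earlier[OF that, of m] m by force
  have ne: "?R \<noteq> {}" using Lk bd[OF Lk] by (auto intro: exI[of _ k])
  define t where "t = Max ?R"
  have t: "t \<in> ?R" unfolding t_def using fin ne by (rule Max_in)
  obtain r where r: "t + 1 \<le> r" "r \<le> t + 1 + int (card states)" "recurrent (st w r)"
    using recurrent_nearby[OF w(1), of "t + 1"] by metis
  have "\<not> left_determined (st w r)"
  proof
    assume l: "left_determined (st w r)"
    then have "r \<in> ?R" using bd[OF l] t r by auto
    then have "r \<le> t" unfolding t_def using fin by (intro Max_ge)
    then show False using r by simp
  qed
  then have "right_determined (st w r)" using wandering_determined[OF df w r(3)] by blast
  \<comment> \<open>Moving forward to a fixed distance from \<open>t\<close>, independent of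
    \<open>w\<close>, prepares the finite count.\<close>
  then have "right_determined (st w (t + 1 + int (card states)))"
    using right_determined_reach[OF reachI[OF w(1) r(2)]] by blast
  then show ?thesis using that t by blast
qed

text \<open>The finite window contains both determining states and everything between them, hence
  fixes the whole point.\<close>

lemma finite_core_points:
  "finite {x \<in> X. left_determined (st x 0) \<and> right_determined (st x (1 + int m))}" (is "finite ?G")
proof (rule inj_on_finite)
  let ?f = "\<lambda>x. window x (- int n) (n + m + 1)"
  show "inj_on ?f ?G"
  proof (rule inj_onI)
    fix x y assume x: "x \<in> ?G" and y: "y \<in> ?G" and "?f x = ?f y"
    then have mid: "x j = y j" if "- int n < j" "j \<le> 1 + int m" for j
      using that window_eq_iff[of x "- int n" "n + m + 1" y "- int n", THEN iffD1, rule_format, of "j + int n"]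
      by (simp add: algebra_simps)
    have s: "st x k = st y k" if "0 \<le> k" "k \<le> 1 + int m" for k using that by (intro st_cong mid) auto
    show "x = y"
    proof
      fix j
      consider "j \<le> 0" | "0 < j" "j \<le> 1 + int m" | "j > 1 + int m" by linarith
      then show "x j = y j"
      proof cases
        case 1
        have "x (0 + j) = y (0 + j)"
          by (rule left_determinedD[of "st x 0"]) (use x y s[of 0] 1 in auto)
        then show ?thesis by simp
      next
        case 2 then show ?thesis using mid by simp
      next
        case 3
        have "x (1 + int m + (j - (1 + int m))) = y (1 + int m + (j - (1 + int m)))"
          by (rule right_determinedD[of "st x (1 + int m)"]) (use x y s[of "1 + int m"] 3 in auto)
        then show ?thesis by simp
      qed
    qed
  qed
  show "?f ` ?G \<subseteq> {w. set w \<subseteq> A \<and> length w = n + m + 1}"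
    using set_window[where A = A] by (auto simp: X_iff length_window)
qed (use finite_lists_length_eq[OF finite_alphabet] in blast)

lemma not_wandering_recurrent: "x \<in> X \<Longrightarrow> \<not> wandering x \<Longrightarrow> recurrent (st x i)"
proof -
  assume x: "x \<in> X" "\<not> wandering x"
  obtain z c d where z: "z \<in> X" "c \<le> d" "st z c = st x (i + 1)" "st z d = st x i"
    using not_wandering_reach[OF x, of "i + 1" i] by (auto simp: reach_def)
  have "st x (i + 1) = st z c" using z by simp
  then obtain y where "y \<in> X" "st y i = st x i" "st y (i + 1 + (d - c)) = st z d"
    using path_append[OF x(1) z(1) _ z(2), of i "i + 1"] by (metis less_add_one less_imp_le)
  then show ?thesis using recurrentI[of y i "i + 1 + (d - c)"] z by simp
qed

text \<open>The states of \<open>x\<close> also occur in wandering points, so \<open>st x 0\<close>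
  is determined on one side. All states of \<open>x\<close> reach each other, which spreads this to
  every time and forces period \<open>L\<close>.\<close>

lemma not_wandering_periodic:
  assumes df: "directly_finite X" and x: "x \<in> wandering_part" "\<not> wandering x"
    and L: "L > 0" "\<And>q. recurrent q \<Longrightarrow> \<exists>c\<in>X. translate (int L) c = c \<and> st c 0 = q"
  shows "translate (int L) x = x"
proof -
  have X: "x \<in> X" using x by (simp add: wandering_part_def)
  have rec: "recurrent (st x i)" for i using not_wandering_recurrent[OF X x(2)] .
  have det: "left_determined (st x 0) \<or> right_determined (st x 0)"
  proof -
    have "st x 0 \<in> wandering_states" using x(1) by (simp add: wandering_part_def)
    then obtain w k where "w \<in> X" "wandering w" "st w k = st x 0"
      by (auto simp: wandering_states_def)
    then show ?thesis using wandering_determined[OF df, of w k] rec[of 0] by simp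
  qed
  show ?thesis
  proof
    fix j
    have "x (j + int L) = x j"
    proof (cases "left_determined (st x 0)")
      case True
      obtain c where "c \<in> X" "translate (int L) c = c" "st c 0 = st x (j + int L)" using L(2) rec by blast
      then show ?thesis
        using left_determined_periodic[OF left_determined_reach[OF not_wandering_reach[OF X x(2)] True] X, of c "int L" "j + int L" "j + int L"]
        by simp
    next
      case False
      then have True: "right_determined (st x 0)" using det by blast
      obtain c where "c \<in> X" "translate (int L) c = c" "st c 0 = st x (j - 1)" using L(2) rec by blast
      then show ?thesis
        using right_determined_periodic[OF right_determined_reach[OF not_wandering_reach[OF X x(2)] True] X, of c "int L" "j - 1" j]
        by simp
    qed
    then show "translate (int L) x j = x j" by simp
  qed
qed

lemma translate_in_wandering_part: "x \<in> wandering_part \<Longrightarrow> translate k x \<in> wandering_part"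
  by (auto simp: wandering_part_def translate_in_X)

text \<open>A wandering point is translated so that its left-determined time is \<open>0\<close>,
  landing in a finite set; the other points of the part have a common period.\<close>

lemma wandering_part_finite_orbits:
  assumes df: "directly_finite X"
  obtains F where "finite F" "F \<subseteq> wandering_part" "\<And>x. x \<in> wandering_part \<Longrightarrow> \<exists>f\<in>F. \<exists>k. x = translate k f"
proof -
  obtain L :: nat where L: "L > 0" "\<And>q. recurrent q \<Longrightarrow> \<exists>c\<in>X. translate (int L) c = c \<and> st c 0 = q"
    by (rule common_period) blast
  let ?G = "{x \<in> X. left_determined (st x 0) \<and> right_determined (st x (1 + int (card states)))}"
  let ?P = "{x. range x \<subseteq> A \<and> translate (int L) x = x}"
  let ?F = "(?G \<union> ?P) \<inter> wandering_part"
  show ?thesis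
  proof
    show "finite ?F" using finite_core_points finite_periodic_points[OF finite_alphabet, of "int L"] L(1) by auto
    fix x assume x: "x \<in> wandering_part"
    then have X: "x \<in> X" by (simp add: wandering_part_def)
    show "\<exists>f\<in>?F. \<exists>k. x = translate k f"
    proof (cases "wandering x")
      case True
      obtain t where t: "left_determined (st x t)" "right_determined (st x (t + 1 + int (card states)))"
        using wandering_core[OF df X True] .
      then have "translate t x \<in> ?F" using X x by (auto simp: translate_in_X translate_in_wandering_part add_ac)
      moreover have "x = translate (- t) (translate t x)" by simp
      ultimately show ?thesis by blast
    next
      case False
      then have "x \<in> ?F" using not_wandering_periodic[OF df x False L] X x by (auto simp: X_iff)
      moreover have "x = translate 0 x" by simp
      ultimately show ?thesis by blast
    qed
  qed auto
qed

text \<open>States are allowed words, so requiring all windows to lie in \<open>Q\<close> already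
  implies membership in \<open>X\<close>.\<close>

lemma part_finite_type:
  assumes "Q \<subseteq> states"
  shows "{x \<in> X. \<forall>i. st x i \<in> Q} = {x. range x \<subseteq> A \<and> (\<forall>i. window x i n \<in> Q)}"
proof -
  have eq: "(\<forall>i. st x i \<in> Q) \<longleftrightarrow> (\<forall>i. window x i n \<in> Q)" for x
    unfolding st_def by (metis add_diff_cancel_right')
  have "states \<subseteq> S" by (auto simp: states_def X_iff)
  then show ?thesis using assms unfolding X_iff eq[symmetric] by blast
qed

end

section \<open>Topology of the full shift\<close>

lemma topspace_full_shift: "topspace (full_shift A) = {x. range x \<subseteq> A}"
  by (auto simp: full_shift_def PiE_UNIV_domain)

lemma openin_cylinder:
  assumes "range x \<subseteq> A"
  shows "openin (full_shift A) {y. range y \<subseteq> A \<and> (\<forall>j\<in>{-m..m}. y j = x j)}"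
proof -
  let ?U = "\<lambda>j. if j \<in> {-m..m} then {x j} else A"
  have "openin (full_shift A) (PiE UNIV ?U)"
    unfolding full_shift_def
  proof (rule product_topology_basis)
    show "openin (discrete_topology A) (?U j)" for j using assms by auto
    have "{j. ?U j \<noteq> topspace (discrete_topology A)} \<subseteq> {-m..m}" by auto
    then show "finite {j. ?U j \<noteq> topspace (discrete_topology A)}" by (rule finite_subset) simp
  qed
  also have "PiE UNIV ?U = {y. range y \<subseteq> A \<and> (\<forall>j\<in>{-m..m}. y j = x j)}"
    using assms by (auto simp: PiE_UNIV_domain Pi_iff split: if_splits) (metis rangeI subsetD singletonD)+
  finally show ?thesis .
qed

lemma openin_full_shift_cylinder:
  assumes "openin (full_shift A) U" "x \<in> U"
  obtains m where "m \<ge> 0" "\<And>y. range y \<subseteq> A \<Longrightarrow> (\<And>j. j \<in> {-m..m} \<Longrightarrow> y j = x j) \<Longrightarrow> y \<in> U"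
proof -
  obtain V where V: "finite {j. V j \<noteq> A}" "x \<in> PiE UNIV V" "PiE UNIV V \<subseteq> U"
    using assms unfolding full_shift_def openin_product_topology_alt by auto
  obtain k where k: "{j. V j \<noteq> A} \<subseteq> {j. \<bar>j\<bar> \<le> k}"
    using finite_int_iff_bounded_le[THEN iffD1, OF V(1)] by auto
  show ?thesis
  proof (rule that[of "max k 0"])
    fix y assume y: "range y \<subseteq> A" "\<And>j. j \<in> {- max k 0..max k 0} \<Longrightarrow> y j = x j"
    have "y j \<in> V j" for j
    proof (cases "V j = A")
      case True then show ?thesis using y(1) by auto
    next
      case False
      then have "j \<in> {- max k 0..max k 0}" using k by fastforce
      then show ?thesis using y(2) V(2) by (simp add: PiE_UNIV_domain Pi_iff)
    qed
    then show "y \<in> U" using V(3) by (auto simp: PiE_UNIV_domain)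
  qed simp
qed

lemma openin_full_shiftI:
  assumes "\<And>x. x \<in> U \<Longrightarrow> range x \<subseteq> A"
    and "\<And>x. x \<in> U \<Longrightarrow> \<exists>m. \<forall>y. range y \<subseteq> A \<and> (\<forall>j\<in>{-m..m}. y j = x j) \<longrightarrow> y \<in> U"
  shows "openin (full_shift A) U"
proof (subst openin_subopen, intro ballI)
  fix x assume x: "x \<in> U"
  obtain m where "\<forall>y. range y \<subseteq> A \<and> (\<forall>j\<in>{-m..m}. y j = x j) \<longrightarrow> y \<in> U" using assms(2)[OF x] by blast
  then show "\<exists>T. openin (full_shift A) T \<and> x \<in> T \<and> T \<subseteq> U"
    using openin_cylinder[OF assms(1)[OF x], of m] assms(1)[OF x]
    by (intro exI[of _ "{y. range y \<subseteq> A \<and> (\<forall>j\<in>{-m..m}. y j = x j)}"]) auto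
qed

lemma shift_eq_translate: "shift = translate 1"
  by (auto simp: shift_def fun_eq_iff)

lemma funpow_shift: "(shift ^^ k) x = translate (int k) x"
  by (induction k) (auto simp: shift_eq_translate add_ac simp del: translate_apply)

lemma subshift_range: "subshift A X \<Longrightarrow> x \<in> X \<Longrightarrow> range x \<subseteq> A"
  using closedin_subset[of "full_shift A" X] by (auto simp: subshift_def topspace_full_shift)

lemma subshift_translate:
  assumes X: "subshift A X" and x: "x \<in> X"
  shows "translate k x \<in> X"
proof -
  have fwd: "translate 1 y \<in> X" if "y \<in> X" for y
    using X that by (auto simp: subshift_def shift_eq_translate simp del: translate_apply)
  have bwd: "translate (- 1) y \<in> X" if "y \<in> X" for y
  proof -
    obtain z where "z \<in> X" "y = translate 1 z"
      using X \<open>y \<in> X\<close> unfolding subshift_def shift_eq_translate by (metis imageE)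
    then show ?thesis by simp
  qed
  have pos: "translate (int m) x \<in> X" for m
  proof (induction m)
    case (Suc m) then show ?case using fwd[OF Suc] by (simp add: add_ac del: translate_apply)
  qed (simp add: x)
  have neg: "translate (- int m) x \<in> X" for m
  proof (induction m)
    case (Suc m)
    have "- 1 + - int m = - int (Suc m)" by simp
    then show ?case using bwd[OF Suc] by (metis translate_translate)
  qed (simp add: x)
  show ?thesis using pos[of "nat k"] neg[of "nat (- k)"] by (cases "k \<ge> 0") auto
qed

lemma endomorphism_closed: "subshift A X \<Longrightarrow> endomorphism A X \<tau> \<Longrightarrow> x \<in> X \<Longrightarrow> \<tau> x \<in> X"
proof -
  assume X: "subshift A X" and \<tau>: "endomorphism A X \<tau>" and x: "x \<in> X"
  have "topspace (subtopology (full_shift A) X) = X"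
    using X closedin_subset[of "full_shift A" X] by (auto simp: subshift_def)
  then show ?thesis using \<tau> x unfolding endomorphism_def continuous_map_def by auto
qed

lemma endomorphism_translate:
  assumes X: "subshift A X" and \<tau>: "endomorphism A X \<tau>" and x: "x \<in> X"
  shows "\<tau> (translate k x) = translate k (\<tau> x)"
proof -
  have step: "\<tau> (translate 1 y) = translate 1 (\<tau> y)" if "y \<in> X" for y
    using \<tau> that by (simp add: endomorphism_def shift_eq_translate del: translate_apply)
  have pos: "\<tau> (translate (int m) y) = translate (int m) (\<tau> y)" if y: "y \<in> X" for m y
  proof (induction m)
    case (Suc m)
    have "\<tau> (translate (int (Suc m)) y) = \<tau> (translate 1 (translate (int m) y))"
      by (simp del: translate_apply)
    also have "\<dots> = translate 1 (\<tau> (translate (int m) y))"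
      by (rule step) (rule subshift_translate[OF X y])
    also have "\<dots> = translate (int (Suc m)) (\<tau> y)" using Suc by (simp del: translate_apply)
    finally show ?case .
  qed simp
  show ?thesis
  proof (cases "k \<ge> 0")
    case True then show ?thesis using pos[OF x, of "nat k"] by simp
  next
    case False
    let ?m = "nat (- k)"
    have "\<tau> (translate (int ?m) (translate k x)) = translate (int ?m) (\<tau> (translate k x))"
      by (rule pos) (rule subshift_translate[OF X x])
    then have "\<tau> x = translate (- k) (\<tau> (translate k x))" using False by simp
    then show ?thesis by (metis add.right_inverse translate_0 translate_translate)
  qed
qed

text \<open>The easy half of Curtis-Hedlund-Lyndon: each coordinate of the image depends on finitely
  many coordinates, and continuity into a product is coordinatewise.\<close>

lemma local_endo_endomorphism:
  assumes X: "subshift A X" and \<tau>: "local_endo X \<tau>"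
  shows "endomorphism A X \<tau>"
proof -
  have closed: "\<tau> x \<in> X" if "x \<in> X" for x using \<tau> that unfolding local_endo_def by blast
  have tr: "\<tau> (translate k x) = translate k (\<tau> x)" if "x \<in> X" for x k
    using \<tau> that unfolding local_endo_def by blast
  obtain N where N: "\<forall>x\<in>X. \<forall>y\<in>X. (\<forall>j\<in>{-N..N}. x j = y j) \<longrightarrow> \<tau> x 0 = \<tau> y 0"
    using \<tau> unfolding local_endo_def by blast
  have loc: "\<tau> x k = \<tau> y k" if x: "x \<in> X" and y: "y \<in> X"
    and eq: "\<And>j. j \<in> {- (N + \<bar>k\<bar>)..N + \<bar>k\<bar>} \<Longrightarrow> y j = x j" for x y k
  proof -
    have "translate k x j = translate k y j" if "j \<in> {-N..N}" for j
    proof -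
      have "j + k \<in> {- (N + \<bar>k\<bar>)..N + \<bar>k\<bar>}" using that unfolding atLeastAtMost_iff by linarith
      then show ?thesis using eq by simp
    qed
    then have "\<tau> (translate k x) 0 = \<tau> (translate k y) 0"
      using N subshift_translate[OF X x] subshift_translate[OF X y] by blast
    then show ?thesis unfolding tr[OF x] tr[OF y] by simp
  qed
  have top: "topspace (subtopology (full_shift A) X) = X"
    using X closedin_subset[of "full_shift A" X] by (auto simp: subshift_def)
  have "continuous_map (subtopology (full_shift A) X) (discrete_topology A) (\<lambda>x. \<tau> x k)" for k
    unfolding continuous_map_def top
  proof (intro conjI allI impI)
    show "(\<lambda>x. \<tau> x k) \<in> X \<rightarrow> topspace (discrete_topology A)"
      using closed subshift_range[OF X] by fastforce
    fix U assume "openin (discrete_topology A) U"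
    \<comment> \<open>A union of cylinders in the full shift whose trace on \<open>X\<close> is the
      preimage of \<open>U\<close> under coordinate \<open>k\<close>.\<close>
    let ?W = "{y. range y \<subseteq> A \<and> (\<exists>x\<in>X. \<tau> x k \<in> U \<and> (\<forall>j\<in>{- (N + \<bar>k\<bar>)..N + \<bar>k\<bar>}. y j = x j))}"
    have W: "openin (full_shift A) ?W"
    proof (rule openin_full_shiftI)
      fix y assume "y \<in> ?W"
      then show "\<exists>m. \<forall>z. range z \<subseteq> A \<and> (\<forall>j\<in>{-m..m}. z j = y j) \<longrightarrow> z \<in> ?W"
        by (intro exI[of _ "N + \<bar>k\<bar>"]) auto
    qed auto
    have "{x \<in> X. \<tau> x k \<in> U} = ?W \<inter> X"
    proof (intro equalityI subsetI)
      fix y assume "y \<in> {x \<in> X. \<tau> x k \<in> U}"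
      then show "y \<in> ?W \<inter> X" using subshift_range[OF X, of y] by blast
    next
      fix y assume "y \<in> ?W \<inter> X"
      then obtain x where "x \<in> X" "\<tau> x k \<in> U" "\<And>j. j \<in> {- (N + \<bar>k\<bar>)..N + \<bar>k\<bar>} \<Longrightarrow> y j = x j" "y \<in> X" by blast
      then show "y \<in> {x \<in> X. \<tau> x k \<in> U}" using loc[of x y k] by simp
    qed
    then show "openin (subtopology (full_shift A) X) {x \<in> X. \<tau> x k \<in> U}"
      using W unfolding openin_subtopology by blast
  qed
  then have "continuous_map (subtopology (full_shift A) X) (full_shift A) \<tau>"
    unfolding full_shift_def[of A] continuous_map_componentwise_UNIV by (simp add: full_shift_def)
  then show ?thesis
    unfolding endomorphism_def continuous_map_in_subtopology shift_eq_translate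
    using closed tr top by auto
qed

lemma subshift_of_finite_type_finite_type:
  assumes "finite A" "subshift_of_finite_type A X"
  obtains n S where "finite_type A n S X"
  using assms unfolding subshift_of_finite_type_def finite_type_def by blast

lemma subshift_of_finite_typeI:
  assumes X: "X = {x. range x \<subseteq> A \<and> (\<forall>i. window x i n \<in> S)}" and S: "S \<subseteq> {w. length w = n \<and> set w \<subseteq> A}"
  shows "subshift_of_finite_type A X"
proof -
  have tr: "translate k x \<in> X" if "x \<in> X" for x k
  proof -
    have "window (translate k x) i n = window x (i + k) n" for i
      by (auto simp: window_def add_ac)
    then show ?thesis using that by (auto simp: X)
  qed
  have "shift ` X = X"
  proof
    show "shift ` X \<subseteq> X" using tr by (auto simp: shift_eq_translate simp del: translate_apply)
    show "X \<subseteq> shift ` X"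
    proof
      fix x assume "x \<in> X"
      then have "translate (- 1) x \<in> X" by (rule tr)
      moreover have "x = shift (translate (- 1) x)" by (simp add: shift_eq_translate del: translate_apply)
      ultimately show "x \<in> shift ` X" by blast
    qed
  qed
  moreover have "closedin (full_shift A) X"
    unfolding closedin_def
  proof
    show "X \<subseteq> topspace (full_shift A)" by (auto simp: X topspace_full_shift)
    show "openin (full_shift A) (topspace (full_shift A) - X)"
    proof (rule openin_full_shiftI)
      fix x assume x: "x \<in> topspace (full_shift A) - X"
      then show "range x \<subseteq> A" by (simp add: topspace_full_shift)
      obtain i where i: "window x i n \<notin> S" using x by (auto simp: X topspace_full_shift)
      show "\<exists>m. \<forall>y. range y \<subseteq> A \<and> (\<forall>j\<in>{-m..m}. y j = x j) \<longrightarrow> y \<in> topspace (full_shift A) - X"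
      proof (intro exI allI impI)
        fix y assume y: "range y \<subseteq> A \<and> (\<forall>j\<in>{- (\<bar>i\<bar> + int n)..\<bar>i\<bar> + int n}. y j = x j)"
        have "y (i + int k) = x (i + int k)" if "k \<in> set [1..<n + 1]" for k
        proof -
          have "int k \<le> int n" using that by auto
          then have "i + int k \<in> {- (\<bar>i\<bar> + int n)..\<bar>i\<bar> + int n}" unfolding atLeastAtMost_iff by linarith
          then show ?thesis using y by blast
        qed
        then have "window y i n = window x i n" unfolding window_def map_eq_conv by blast
        then have "window y i n \<notin> S" using i by simp
        then show "y \<in> topspace (full_shift A) - X" using y by (auto simp: X topspace_full_shift)
      qed
    qed
  qed
  ultimately show ?thesis unfolding subshift_of_finite_type_def subshift_def using X S by blast
qed

section \<open>The two parts as subshifts, and density of periodic points\<close>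

context finite_type
begin

lemma part_subshift_of_finite_type:
  assumes "Q \<subseteq> states"
  shows "subshift_of_finite_type A {x \<in> X. \<forall>i. st x i \<in> Q}"
proof (rule subshift_of_finite_typeI[OF part_finite_type[OF assms]])
  have "states \<subseteq> {w. length w = n \<and> set w \<subseteq> A}"
    using set_window[where A = A] by (auto simp: states_def st_def X_iff length_window)
  then show "Q \<subseteq> {w. length w = n \<and> set w \<subseteq> A}" using assms by blast
qed

lemma wandering_part_subshift: "subshift_of_finite_type A wandering_part"
  unfolding wandering_part_def
  by (rule part_subshift_of_finite_type) (auto simp: wandering_states_def st_in_states)

lemma recurrent_part_subshift: "subshift_of_finite_type A recurrent_part"
proof -
  have "recurrent_part = {x \<in> X. \<forall>i. st x i \<in> states - wandering_states}"
    by (auto simp: recurrent_part_def st_in_states)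
  then show ?thesis using part_subshift_of_finite_type[of "states - wandering_states"] by auto
qed

lemma recurrent_part_non_wandering: "non_wandering A recurrent_part"
  unfolding non_wandering_def
proof (intro ballI allI impI)
  fix x U assume x: "x \<in> recurrent_part" and U: "U \<subseteq> recurrent_part"
    and "\<exists>V. openin (subtopology (full_shift A) recurrent_part) V \<and> x \<in> V \<and> V \<subseteq> U"
  then obtain V where V: "openin (full_shift A) V" "x \<in> V" "V \<inter> recurrent_part \<subseteq> U"
    unfolding openin_subtopology by auto
  obtain m where m: "m \<ge> 0" "\<And>y. range y \<subseteq> A \<Longrightarrow> (\<And>j. j \<in> {-m..m} \<Longrightarrow> y j = x j) \<Longrightarrow> y \<in> V"
    using openin_full_shift_cylinder[OF V(1,2)] by blast
  have rng: "range y \<subseteq> A" if "y \<in> recurrent_part" for y using that by (auto simp: recurrent_part_def X_iff)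
  \<comment> \<open>The replay starts strictly after \<open>i\<close>, so \<open>i = - m - 1\<close>
    makes it cover the whole window.\<close>
  obtain z p where z: "z \<in> recurrent_part" "p > 0" "\<And>j. j \<le> m \<Longrightarrow> z j = x j" "\<And>j. j > - m - 1 \<Longrightarrow> z (j + p) = x j"
    using recurrent_part_return[OF x, of "- m - 1" m] m(1) by auto
  have zU: "z \<in> U" using z V m(2)[of z] rng[OF z(1)] by auto
  have tz: "translate p z \<in> recurrent_part"
    using z(1) by (auto simp: recurrent_part_def translate_in_X)
  have "translate p z \<in> V" using z(4) by (intro m(2) rng[OF tz]) auto
  then have tU: "translate p z \<in> U" using V tz by blast
  have "(shift ^^ nat p) z = translate p z" using z(2) by (simp add: funpow_shift)
  then have "translate p z \<in> U \<inter> (shift ^^ nat p) ` U" using zU tU by (metis IntI imageI)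
  then show "\<exists>k\<ge>1. U \<inter> (shift ^^ k) ` U \<noteq> {}" using z(2) by (intro exI[of _ "nat p"]) auto
qed

text \<open>A return of a cylinder around \<open>x\<close> to itself yields a path that repeats a
  long block, and \<open>periodic_closing\<close> makes it periodic.\<close>

lemma non_wandering_periodic_dense:
  assumes nw: "non_wandering A X" and x: "x \<in> X"
  obtains p L where "p \<in> X" "L > 0" "translate L p = p" "\<And>j. j \<in> {-m..m} \<Longrightarrow> p j = x j"
proof -
  \<comment> \<open>The window must contain the prescribed one and have at least \<open>n\<close>
    symbols for \<open>periodic_closing\<close>.\<close>
  define M where "M = max \<bar>m\<bar> (int n)"
  have M: "M \<ge> 0" "int n \<le> M" "m \<le> M" by (auto simp: M_def)
  let ?V = "{y. range y \<subseteq> A \<and> (\<forall>j\<in>{-M..M}. y j = x j)}"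
  let ?U = "X \<inter> ?V"
  have "openin (subtopology (full_shift A) X) ?U"
    using openin_cylinder[of x A M] x by (auto simp: X_iff openin_subtopology)
  moreover have "x \<in> ?U" using x by (auto simp: X_iff)
  ultimately have "\<exists>V. openin (subtopology (full_shift A) X) V \<and> x \<in> V \<and> V \<subseteq> ?U" by blast
  then have "\<exists>k\<ge>1. ?U \<inter> (shift ^^ k) ` ?U \<noteq> {}"
    by (rule nw[unfolded non_wandering_def, rule_format, OF x Int_lower1])
  then obtain k :: nat where k: "k \<ge> 1" "?U \<inter> (shift ^^ k) ` ?U \<noteq> {}" by blast
  then obtain z where z: "z \<in> ?U" "(shift ^^ k) z \<in> ?U" by blast
  have e1: "z j = x j" if "j \<in> {-M..M}" for j using z(1) that by simp
  have e2: "z (j + int k) = x j" if "j \<in> {-M..M}" for j using z(2) that unfolding funpow_shift by simp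
  have zX: "z \<in> X" using z(1) by blast
  \<comment> \<open>Closing at time \<open>M\<close> with \<open>2 * M + 1\<close> matching symbols
    keeps all of \<open>{-M..M}\<close>, even if the return time is shorter than this
    window.\<close>
  obtain c where c: "c \<in> X" "translate (int k) c = c"
    "\<And>j. - int (nat (2 * M + 1)) < j \<Longrightarrow> j \<le> int k \<Longrightarrow> c j = z (M + j)"
  proof (rule periodic_closing[OF zX, of "int k" "nat (2 * M + 1)" M])
    show "z (M - j) = z (M + int k - j)" if "0 \<le> j" "j < int (nat (2 * M + 1))" for j
      using e1[of "M - j"] e2[of "M - j"] that M by (simp add: algebra_simps)
  qed (use k M in auto)
  show ?thesis
  proof (rule that[of "translate (- M) c" "int k"])
    show "translate (- M) c \<in> X" using c(1) by (rule translate_in_X)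
    have "translate (int k) (translate (- M) c) = translate (- M) (translate (int k) c)"
      by (simp add: add.commute del: translate_apply)
    then show "translate (int k) (translate (- M) c) = translate (- M) c" using c(2) by simp
    show "translate (- M) c j = x j" if "j \<in> {-m..m}" for j
      using c(3)[of "j - M"] e1[of j] that M k by auto
  qed (use k in auto)
qed

end

section \<open>Endomorphisms and orbits\<close>

definition orbit :: "(int \<Rightarrow> 'a) \<Rightarrow> (int \<Rightarrow> 'a) set" where
  "orbit x = range (\<lambda>k. translate k x)"

lemma orbit_self: "x \<in> orbit x"
  unfolding orbit_def by (metis rangeI translate_0)

lemma orbit_translate [simp]: "orbit (translate k x) = orbit x"
proof
  show "orbit (translate k x) \<subseteq> orbit x" by (auto simp: orbit_def simp del: translate_apply)
  show "orbit x \<subseteq> orbit (translate k x)"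
  proof
    fix y assume "y \<in> orbit x"
    then obtain l where "y = translate l x" by (auto simp: orbit_def)
    then have "y = translate (l - k) (translate k x)" by simp
    then show "y \<in> orbit (translate k x)" unfolding orbit_def by blast
  qed
qed

lemma finite_orbits:
  assumes "finite F" "\<And>x. x \<in> W \<Longrightarrow> \<exists>f\<in>F. \<exists>k. x = translate k f"
  shows "finite (orbit ` W)"
proof (rule finite_subset)
  show "orbit ` W \<subseteq> orbit ` F" using assms(2) by force
qed (use assms in simp)

lemma image_orbit:
  assumes "subshift A X" "endomorphism A X \<tau>" "x \<in> X"
  shows "\<tau> ` orbit x = orbit (\<tau> x)"
  unfolding orbit_def image_image using endomorphism_translate[OF assms] by simp

lemma orbit_subset: "subshift A X \<Longrightarrow> x \<in> X \<Longrightarrow> orbit x \<subseteq> X"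
  using subshift_translate by (force simp: orbit_def)

text \<open>A surjection permutes the finitely many orbits. Points with equal images therefore lie
  in one orbit, and a power of \<open>\<tau>\<close> acts on that orbit as a translation, which is
  injective.\<close>

lemma finite_orbits_injunctive:
  assumes X: "subshift A X" and fin: "finite (orbit ` X)"
  shows "injunctive A X"
  unfolding injunctive_def
proof (intro allI impI)
  fix \<tau> assume "endomorphism A X \<tau> \<and> \<tau> ` X = X"
  then have \<tau>: "endomorphism A X \<tau>" and surj: "\<tau> ` X = X" by auto
  have closed: "\<tau> x \<in> X" if "x \<in> X" for x using endomorphism_closed[OF X \<tau> that] .
  have "(\<lambda>B. \<tau> ` B) ` orbit ` X = orbit ` \<tau> ` X"
    unfolding image_image using image_orbit[OF X \<tau>] by (rule image_cong[OF refl])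
  then have "inj_on (\<lambda>B. \<tau> ` B) (orbit ` X)" using fin surj by (intro eq_card_imp_inj_on) auto
  then have inj: "orbit x = orbit y" if "orbit (\<tau> x) = orbit (\<tau> y)" "x \<in> X" "y \<in> X" for x y
    using that image_orbit[OF X \<tau>] unfolding inj_on_def by (metis imageI)
  have it_closed: "(\<tau> ^^ m) x \<in> X" if "x \<in> X" for m x
    using that closed by (induction m) auto
  have it_translate: "(\<tau> ^^ m) (translate k x) = translate k ((\<tau> ^^ m) x)" if "x \<in> X" for m k x
    by (induction m) (auto simp: endomorphism_translate[OF X \<tau> it_closed[OF that]] simp del: translate_apply)
  \<comment> \<open>Injectivity on orbits pulls a coincidence between iterates back to
    \<open>x\<close> itself.\<close>
  have cancel: "orbit ((\<tau> ^^ i) x) = orbit ((\<tau> ^^ (i + d)) x) \<Longrightarrow> orbit x = orbit ((\<tau> ^^ d) x)" if "x \<in> X" for i d x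
    by (induction i) (auto simp: it_closed[OF that] dest: inj)
  show "inj_on \<tau> X"
  proof (rule inj_onI)
    fix x y assume x: "x \<in> X" and y: "y \<in> X" and eq: "\<tau> x = \<tau> y"
    then have "orbit y = orbit x" using inj[of y x] by simp
    then obtain k where k: "y = translate k x" using orbit_self[of y] by (auto simp: orbit_def)
    have "(\<lambda>m. orbit ((\<tau> ^^ m) x)) ` UNIV \<subseteq> orbit ` X" using it_closed[OF x] by auto
    then have "finite (range (\<lambda>m. orbit ((\<tau> ^^ m) x)))" using fin by (rule finite_subset)
    then have "\<not> inj (\<lambda>m. orbit ((\<tau> ^^ m) x))" by (metis finite_imageD infinite_UNIV_nat)
    then obtain i j where ij: "i < j" "orbit ((\<tau> ^^ i) x) = orbit ((\<tau> ^^ j) x)"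
      unfolding inj_def by (metis linorder_neqE_nat)
    \<comment> \<open>The exponent is kept as \<open>Suc d\<close>: at least one application of
      \<open>\<tau>\<close> is needed to exploit that the images of \<open>x\<close> and
      \<open>y\<close> are equal.\<close>
    define d where "d = j - i - 1"
    have "j = i + Suc d" using ij(1) by (simp add: d_def)
    then have "orbit x = orbit ((\<tau> ^^ Suc d) x)" using cancel[OF x, of i "Suc d"] ij(2) by simp
    then obtain l where l: "(\<tau> ^^ Suc d) x = translate l x" using orbit_self[of "(\<tau> ^^ Suc d) x"] by (auto simp: orbit_def)
    have "translate l x = (\<tau> ^^ Suc d) y" using l eq by (simp add: funpow_Suc_right del: funpow.simps)
    also have "\<dots> = translate k (translate l x)" unfolding k it_translate[OF x] l ..
    finally have "translate l x = translate (k + l) x" by simp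
    then show "x = y" unfolding translate_eq_iff k by simp
  qed
qed

section \<open>Surjunctivity from periodic points and finitely many orbits\<close>

lemma compact_space_full_shift: "finite A \<Longrightarrow> compact_space (full_shift A)"
  unfolding full_shift_def compact_space_product_topology
  by (auto simp: compact_space_discrete_topology)

lemma Hausdorff_space_full_shift: "Hausdorff_space (full_shift A)"
  unfolding full_shift_def Hausdorff_space_product_topology by auto

text \<open>\<open>X\<close> splits into the closure \<open>C\<close> of its periodic points and a
  remainder made of finitely many orbits; finiteness at each period and finiteness of the remainder
  give surjectivity on each piece.\<close>

lemma surjunctiveI:
  assumes A: "finite A" and X: "subshift A X" and F: "finite F"
    and cover: "\<And>x. x \<in> X \<Longrightarrow> (\<forall>m. \<exists>p\<in>X. \<exists>L>0. translate L p = p \<and> (\<forall>j\<in>{-m..m}. p j = x j)) \<or>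
        (\<exists>f\<in>F. \<exists>k. x = translate k f)"
  shows "surjunctive A X"
  unfolding surjunctive_def
proof (intro allI impI)
  fix \<tau> assume "endomorphism A X \<tau> \<and> inj_on \<tau> X"
  then have \<tau>: "endomorphism A X \<tau>" and inj: "inj_on \<tau> X" by auto
  have closed: "\<tau> x \<in> X" if "x \<in> X" for x using endomorphism_closed[OF X \<tau> that] .
  let ?P = "{p \<in> X. \<exists>L>0. translate L p = p}"
  define C where "C = full_shift A closure_of ?P"
  have clX: "closedin (full_shift A) X" using X by (simp add: subshift_def)
  have CX: "C \<subseteq> X" unfolding C_def by (rule closure_of_minimal[OF _ clX]) auto
  have PC: "?P \<subseteq> \<tau> ` C"
  proof
    fix p assume "p \<in> ?P"
    then obtain L where p: "p \<in> X" "L > 0" "translate L p = p" by auto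
    \<comment> \<open>For fixed \<open>L\<close> these points form a finite set that
      \<open>\<tau>\<close> maps injectively into itself, hence onto.\<close>
    let ?Q = "{x \<in> X. translate L x = x}"
    have "?Q \<subseteq> {x. range x \<subseteq> A \<and> translate L x = x}" using subshift_range[OF X] by blast
    then have "finite ?Q" using finite_periodic_points[OF A p(2)] by (rule finite_subset)
    moreover have "\<tau> ` ?Q \<subseteq> ?Q" using closed endomorphism_translate[OF X \<tau>] by (auto simp del: translate_apply) metis
    moreover have "inj_on \<tau> ?Q" using inj by (rule inj_on_subset) auto
    ultimately have "\<tau> ` ?Q = ?Q" by (rule endo_inj_surj)
    then obtain q where q: "q \<in> ?Q" "p = \<tau> q" using p by blast
    have "?P \<subseteq> C" unfolding C_def using subshift_range[OF X]
      by (intro closure_of_subset) (auto simp: topspace_full_shift)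
    then show "p \<in> \<tau> ` C" using q p(2) by blast
  qed
  \<comment> \<open>Compactness makes the image of \<open>C\<close> closed; as it contains the
    periodic points, it contains \<open>C\<close>.\<close>
  have "compactin (full_shift A) C"
    unfolding C_def by (intro closedin_compact_space compact_space_full_shift A closedin_closure_of)
  then have "compactin (subtopology (full_shift A) X) C" using CX by (simp add: compactin_subtopology)
  then have "compactin (subtopology (full_shift A) X) (\<tau> ` C)"
    using \<tau> unfolding endomorphism_def by (blast intro: image_compactin)
  then have "compactin (full_shift A) (\<tau> ` C)" by (simp add: compactin_subtopology)
  then have "closedin (full_shift A) (\<tau> ` C)" by (intro compactin_imp_closedin Hausdorff_space_full_shift)
  then have C\<tau>: "C \<subseteq> \<tau> ` C" using PC unfolding C_def by (intro closure_of_minimal)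
  \<comment> \<open>Each point of \<open>C\<close> already has a preimage in \<open>C\<close>, so by
    injectivity nothing outside \<open>C\<close> can be sent into it.\<close>
  have stay: "\<tau> x \<in> X - C" if "x \<in> X - C" for x
  proof -
    have "\<tau> x \<notin> C"
    proof
      assume "\<tau> x \<in> C"
      then obtain c where "c \<in> C" "\<tau> x = \<tau> c" using C\<tau> by blast
      then have "x = c" using inj CX that by (auto dest: inj_onD)
      then show False using that \<open>c \<in> C\<close> by simp
    qed
    then show ?thesis using closed that by simp
  qed
  have dense: "x \<in> C" if x: "x \<in> X" and d: "\<forall>m. \<exists>p\<in>X. \<exists>L>0. translate L p = p \<and> (\<forall>j\<in>{-m..m}. p j = x j)" for x
    unfolding C_def in_closure_of
  proof (intro conjI allI impI)
    show "x \<in> topspace (full_shift A)" using subshift_range[OF X x] by (simp add: topspace_full_shift)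
    fix T assume T: "x \<in> T \<and> openin (full_shift A) T"
    then obtain m where m: "\<And>y. range y \<subseteq> A \<Longrightarrow> (\<And>j. j \<in> {-m..m} \<Longrightarrow> y j = x j) \<Longrightarrow> y \<in> T"
      using openin_full_shift_cylinder by metis
    obtain p where p: "p \<in> ?P" "\<forall>j\<in>{-m..m}. p j = x j" using d by blast
    then have "p \<in> T" using subshift_range[OF X, of p] by (intro m) auto
    then show "\<exists>y. y \<in> ?P \<and> y \<in> T" using p by blast
  qed
  \<comment> \<open>\<open>\<tau>\<close> maps these finitely many orbits injectively to orbits of
    the same kind, so it permutes them.\<close>
  let ?O = "orbit ` (X - C)"
  have "finite ?O"
  proof (rule finite_orbits[OF F])
    show "\<exists>f\<in>F. \<exists>k. x = translate k f" if "x \<in> X - C" for x using cover[of x] dense[of x] that by blast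
  qed
  moreover have "(\<lambda>B. \<tau> ` B) ` ?O \<subseteq> ?O" using image_orbit[OF X \<tau>] stay by auto
  moreover have "inj_on (\<lambda>B. \<tau> ` B) ?O"
    using inj_on_image_eq_iff[OF inj] orbit_subset[OF X] unfolding inj_on_def by auto
  ultimately have "(\<lambda>B. \<tau> ` B) ` ?O = ?O" by (rule endo_inj_surj)
  then have "x \<in> \<tau> ` X" if "x \<in> X - C" for x
  proof -
    assume eq: "(\<lambda>B. \<tau> ` B) ` ?O = ?O"
    have "orbit x \<in> (\<lambda>B. \<tau> ` B) ` ?O" unfolding eq using that by blast
    then obtain y where "y \<in> X" "orbit x = \<tau> ` orbit y" by blast
    then show ?thesis using orbit_self[of x] orbit_subset[OF X, of y] by blast
  qed
  then have "X \<subseteq> \<tau> ` X" using C\<tau> CX by blast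
  then show "\<tau> ` X = X" using closed by blast
qed

section \<open>Direct finiteness and the equivalence\<close>

lemma surjunctive_directly_finite:
  assumes "subshift A X" "surjunctive A X"
  shows "directly_finite X"
  unfolding directly_finite_def
proof (intro allI impI)
  fix \<rho> \<tau> assume *: "local_endo X \<rho> \<and> local_endo X \<tau> \<and> (\<forall>x\<in>X. \<rho> (\<tau> x) = x)"
  then have "inj_on \<tau> X" by (metis inj_on_inverseI)
  then show "\<tau> ` X = X" using * assms local_endo_endomorphism unfolding surjunctive_def by blast
qed

text \<open>A left inverse \<open>\<rho>\<close> is onto and hence injective; cancelling it in
  \<open>\<rho> (\<tau> (\<rho> x)) = \<rho> x\<close> shows that it is a right inverse too.\<close>

lemma injunctive_directly_finite:
  assumes "subshift A X" "injunctive A X"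
  shows "directly_finite X"
  unfolding directly_finite_def
proof (intro allI impI)
  fix \<rho> \<tau> assume *: "local_endo X \<rho> \<and> local_endo X \<tau> \<and> (\<forall>x\<in>X. \<rho> (\<tau> x) = x)"
  then have closed: "\<rho> x \<in> X" "\<tau> x \<in> X" if "x \<in> X" for x using that unfolding local_endo_def by blast+
  have "X \<subseteq> \<rho> ` X" using * closed by (metis imageI subsetI)
  then have "\<rho> ` X = X" using closed by blast
  then have inj: "inj_on \<rho> X" using * assms local_endo_endomorphism unfolding injunctive_def by blast
  have "\<tau> (\<rho> x) = x" if "x \<in> X" for x
    using inj by (rule inj_onD) (use * closed that in auto)
  then show "\<tau> ` X = X" using closed by (metis (no_types, lifting) image_iff subsetI subset_antisym)
qed

theorem mainTheorem6:
  fixes A :: "'a set" and X :: "(int \<Rightarrow> 'a) set"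
  assumes "finite A" and "subshift_of_finite_type A X"
  shows "surjunctive A X \<longleftrightarrow>
    (\<exists>Y Z. subshift_of_finite_type A Y \<and> non_wandering A Y \<and>
           subshift_of_finite_type A Z \<and> injunctive A Z \<and>
           Y \<inter> Z = {} \<and> X = Y \<union> Z)"
proof
  assume surj: "surjunctive A X"
  obtain n S where "finite_type A n S X" using subshift_of_finite_type_finite_type[OF assms] .
  then interpret finite_type A n S X .
  have "directly_finite X"
    using surj assms(2) surjunctive_directly_finite unfolding subshift_of_finite_type_def by blast
  then obtain F where F: "finite F" "\<And>x. x \<in> wandering_part \<Longrightarrow> \<exists>f\<in>F. \<exists>k. x = translate k f"
    by (rule wandering_part_finite_orbits) blast
  have "injunctive A wandering_part"
    using wandering_part_subshift finite_orbits[OF F]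
    by (intro finite_orbits_injunctive) (auto simp: subshift_of_finite_type_def)
  then show "\<exists>Y Z. subshift_of_finite_type A Y \<and> non_wandering A Y \<and>
      subshift_of_finite_type A Z \<and> injunctive A Z \<and> Y \<inter> Z = {} \<and> X = Y \<union> Z"
    using recurrent_part_subshift recurrent_part_non_wandering wandering_part_subshift
      parts_disjoint parts_cover by blast
next
  assume "\<exists>Y Z. subshift_of_finite_type A Y \<and> non_wandering A Y \<and>
      subshift_of_finite_type A Z \<and> injunctive A Z \<and> Y \<inter> Z = {} \<and> X = Y \<union> Z"
  then obtain Y Z where Y: "subshift_of_finite_type A Y" "non_wandering A Y"
    and Z: "subshift_of_finite_type A Z" "injunctive A Z" and X: "X = Y \<union> Z" by blast
  obtain n S where "finite_type A n S Z" using subshift_of_finite_type_finite_type[OF assms(1) Z(1)] .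
  then interpret Z: finite_type A n S Z .
  \<comment> \<open>The forward analysis is reused for \<open>Z\<close>: its wandering part supplies
    the finitely many orbits, and its recurrent part joins \<open>Y\<close> as a source of periodic
    points.\<close>
  have "directly_finite Z"
    using Z injunctive_directly_finite unfolding subshift_of_finite_type_def by blast
  then obtain F where F: "finite F" "\<And>x. x \<in> Z.wandering_part \<Longrightarrow> \<exists>f\<in>F. \<exists>k. x = translate k f"
    by (rule Z.wandering_part_finite_orbits) blast
  have dense: "\<forall>m. \<exists>p\<in>X. \<exists>L>0. translate L p = p \<and> (\<forall>j\<in>{-m..m}. p j = x j)"
    if W: "subshift_of_finite_type A W" "non_wandering A W" "W \<subseteq> X" and x: "x \<in> W" for W x
  proof
    fix m
    obtain k T where "finite_type A k T W" using subshift_of_finite_type_finite_type[OF assms(1) W(1)] .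
    then interpret W: finite_type A k T W .
    show "\<exists>p\<in>X. \<exists>L>0. translate L p = p \<and> (\<forall>j\<in>{-m..m}. p j = x j)"
      by (rule W.non_wandering_periodic_dense[OF W(2) x, of m]) (use W(3) in blast)
  qed
  have Zr: "Z.recurrent_part \<subseteq> X" using X Z.parts_cover by blast
  show "surjunctive A X"
  proof (rule surjunctiveI[OF assms(1) _ F(1)])
    show "subshift A X" using assms(2) by (simp add: subshift_of_finite_type_def)
    fix x assume "x \<in> X"
    then consider "x \<in> Y" | "x \<in> Z.recurrent_part" | "x \<in> Z.wandering_part"
      using X Z.parts_cover by blast
    then show "(\<forall>m. \<exists>p\<in>X. \<exists>L>0. translate L p = p \<and> (\<forall>j\<in>{-m..m}. p j = x j)) \<or>
        (\<exists>f\<in>F. \<exists>k. x = translate k f)"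
    proof cases
      case 1 then show ?thesis using dense[OF Y] X by blast
    next
      case 2
      then show ?thesis
        using dense[OF Z.recurrent_part_subshift Z.recurrent_part_non_wandering Zr] by blast
    next
      case 3 then show ?thesis using F(2) by blast
    qed
  qed
qed

end
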